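(* Let $\mathbb X$ be a countable ultrahomogeneous partial order. Then (a) there are maximal antichains of size $2^{\aleph_0}$ in the poset $\langle\mathbb P(\mathbb X),\subset\rangle$; (b) there are countably infinite maximal antichains in $\langle\mathbb P(\mathbb X),\subset\rangle$ if and only if $\mathbb X$ is isomorphic neither to $\mathbb A_\omega$ nor to $\mathbb B_\omega$.
   Context: A structure is ultrahomogeneous iff every isomorphism between finite substructures extends to an automorphism. $\mathbb P(\mathbb X)$ is the set of subsets $A\subseteq X$ such that the induced suborder on $A$ is isomorphic to $\mathbb X$. In a poset, two elements are compatible iff they have a common lower bound in the poset; an antichain is a set of pairwise incompatible elements, maximal iff every element is compatible with some member of it. $\mathbb A_\omega$ is the countable antichain (the empty order relation on $\omega$). $\mathbb B_\omega=\omega\times\mathbb Q$ ordered by $\langle i_1,q_1\rangle<\langle i_2,q_2\rangle$ iff $i_1=i_2$ and $q_1<_{\mathbb Q}q_2$ (countably many disjoint incomparable copies of the rationals). *)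

theory Defs
  imports Complex_Main "HOL-Library.Equipollence"
begin

(* A partial order is a carrier set together with a strict order on it; values of the
   relation outside the carrier are irrelevant to every notion below. *)

definition strict_poset :: "'a set \<Rightarrow> ('a \<Rightarrow> 'a \<Rightarrow> bool) \<Rightarrow> bool" where
  "strict_poset X r \<longleftrightarrow> irreflp_on X r \<and> transp_on X r"

definition rel_iso :: "'a set \<Rightarrow> ('a \<Rightarrow> 'a \<Rightarrow> bool) \<Rightarrow> 'b set \<Rightarrow> ('b \<Rightarrow> 'b \<Rightarrow> bool) \<Rightarrow> ('a \<Rightarrow> 'b) \<Rightarrow> bool" where
  "rel_iso A r B s f \<longleftrightarrow>
     bij_betw f A B \<and> (\<forall>x\<in>A. \<forall>y\<in>A. r x y \<longleftrightarrow> s (f x) (f y))"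

definition isomorphic :: "'a set \<Rightarrow> ('a \<Rightarrow> 'a \<Rightarrow> bool) \<Rightarrow> 'b set \<Rightarrow> ('b \<Rightarrow> 'b \<Rightarrow> bool) \<Rightarrow> bool" where
  "isomorphic A r B s \<longleftrightarrow> (\<exists>f. rel_iso A r B s f)"

definition ultrahomogeneous :: "'a set \<Rightarrow> ('a \<Rightarrow> 'a \<Rightarrow> bool) \<Rightarrow> bool" where
  "ultrahomogeneous X r \<longleftrightarrow>
     (\<forall>F G f. F \<subseteq> X \<and> G \<subseteq> X \<and> finite F \<and> finite G \<and> rel_iso F r G r f \<longrightarrow>
        (\<exists>g. rel_iso X r X r g \<and> (\<forall>x\<in>F. g x = f x)))"

definition copies :: "'a set \<Rightarrow> ('a \<Rightarrow> 'a \<Rightarrow> bool) \<Rightarrow> 'a set set" where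
  "copies X r = {A. A \<subseteq> X \<and> isomorphic A r X r}"

(* In the next three definitions le is the reflexive order of the poset with carrier P. *)

definition compatible_in :: "'p set \<Rightarrow> ('p \<Rightarrow> 'p \<Rightarrow> bool) \<Rightarrow> 'p \<Rightarrow> 'p \<Rightarrow> bool" where
  "compatible_in P le a b \<longleftrightarrow> (\<exists>c\<in>P. le c a \<and> le c b)"

definition antichain_in :: "'p set \<Rightarrow> ('p \<Rightarrow> 'p \<Rightarrow> bool) \<Rightarrow> 'p set \<Rightarrow> bool" where
  "antichain_in P le C \<longleftrightarrow>
     C \<subseteq> P \<and> (\<forall>a\<in>C. \<forall>b\<in>C. a \<noteq> b \<longrightarrow> \<not> compatible_in P le a b)"

definition maximal_antichain_in :: "'p set \<Rightarrow> ('p \<Rightarrow> 'p \<Rightarrow> bool) \<Rightarrow> 'p set \<Rightarrow> bool" where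
  "maximal_antichain_in P le C \<longleftrightarrow>
     antichain_in P le C \<and> (\<forall>p\<in>P. \<exists>a\<in>C. compatible_in P le p a)"

definition A_omega_less :: "nat \<Rightarrow> nat \<Rightarrow> bool" where
  "A_omega_less m n \<longleftrightarrow> False"

definition B_omega_less :: "nat \<times> rat \<Rightarrow> nat \<times> rat \<Rightarrow> bool" where
  "B_omega_less x y \<longleftrightarrow> fst x = fst y \<and> snd x < snd y"

end

theory Submission
  imports Defs
begin

text \<open>
  The countable ultrahomogeneous partial orders fall into four types: the antichain, orders in
  which incomparability is transitive, disjoint unions of chains, and orders that are directed
  both ways and contain a point incomparable to both elements of a two-element chain. The last
  type realizes every consistent one-point extension of a finite subset.

  Subsets of size continuum come from a Cantor tree: if every one-type over a finite set has
  infinitely many realizations (up to a suitable equivalence), realizations can be attached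
  injectively to the finite binary words so that every branch is a copy and two branches share
  only finitely many points. Zorn's lemma makes this antichain maximal.

  A countably infinite maximal antichain is obtained by slicing along a cofinal increasing
  sequence \<open>d\<close>: the \<open>n\<close>-th copy lies below \<open>d (Suc n)\<close> but not below \<open>d n\<close>, and every copy of
  the order contains a smaller one inside a single slice. When the order has infinitely many
  components, each of them dense or a singleton, a diagonal argument defeats every countably
  infinite antichain.
\<close>

section \<open>Back and forth, and ultrahomogeneous orders\<close>

text \<open>Two obstacles shape the countable case. The sequence \<open>d\<close> may only cut a
  part of the order that no copy can miss: all of it when the order is directed, one component when
  there are finitely many. With infinitely many components a copy can drop any single one, and this
  freedom is what the diagonal argument uses. Moreover a slice need not be a copy: if
  incomparability is transitive, the class of \<open>d n\<close> forms a layer of minimal points in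
  it. So a slice only has to contain a copy that includes every slice point with a predecessor also
  not below \<open>d n\<close>; this suffices because copies have no minimal points. The
  classification is derived by transport: a small picture found somewhere is moved by an
  automorphism onto given points, and its remaining point is the one wanted. In the directed type
  the point beside a two-element chain breeds the N, and the N breeds the wedge and the vee with an
  isolated point. These four pictures, with interpolation, carry the induction that proves the
  extension property.\<close>

definition coherent :: "('a \<Rightarrow> 'b \<Rightarrow> 'a \<Rightarrow> 'b \<Rightarrow> bool) \<Rightarrow> ('a \<times> 'b) set \<Rightarrow> bool" where
  "coherent c S \<longleftrightarrow> (\<forall>(x, y)\<in>S. \<forall>(x', y')\<in>S. c x y x' y')"

text \<open>A finite partial isomorphism is kept as a relation whose pairs are tested two at a time
  by \<open>c\<close>; order, equality and component labels never concern more than two points.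
  \<open>c\<close> stays abstract so that one construction serves plain orders and orders with
  labelled components, and \<open>eq\<close> makes the limit relation the graph of an
  injection.\<close>

lemma back_and_forth:
  fixes c :: "'a \<Rightarrow> 'b \<Rightarrow> 'a \<Rightarrow> 'b \<Rightarrow> bool"
  assumes "countable X" "countable Y"
    and eq: "\<And>x y x' y'. c x y x' y' \<Longrightarrow> x = x' \<longleftrightarrow> y = y'"
    and forward: "\<And>S x. \<lbrakk>finite S; S \<subseteq> X \<times> Y; coherent c S; x \<in> X\<rbrakk>
      \<Longrightarrow> \<exists>y\<in>Y. coherent c (insert (x, y) S)"
    and backward: "\<And>S y. \<lbrakk>finite S; S \<subseteq> X \<times> Y; coherent c S; y \<in> Y\<rbrakk>
      \<Longrightarrow> \<exists>x\<in>X. coherent c (insert (x, y) S)"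
  shows "\<exists>f. bij_betw f X Y \<and> (\<forall>x\<in>X. \<forall>x'\<in>X. c x (f x) x' (f x'))"
proof -
  define Q where "Q S \<longleftrightarrow> finite S \<and> S \<subseteq> X \<times> Y \<and> coherent c S" for S
  have f1: "\<exists>S'. Q S' \<and> S \<subseteq> S' \<and> (\<forall>x\<in>X. to_nat_on X x = n \<longrightarrow> x \<in> fst ` S')" if "Q S" for S n
  proof (cases "\<exists>x\<in>X. to_nat_on X x = n")
    case True
    then obtain x where x: "x \<in> X" "to_nat_on X x = n" by blast
    have QS: "finite S" "S \<subseteq> X \<times> Y" "coherent c S" using that by (simp_all add: Q_def)
    obtain y where y: "y \<in> Y" "coherent c (insert (x, y) S)"
      using forward[OF QS x(1)] by blast
    have "z = x" if "z \<in> X" "to_nat_on X z = n" for z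
      using to_nat_on_inj[OF \<open>countable X\<close> that(1) x(1)] that(2) x(2) by simp
    then have "\<forall>z\<in>X. to_nat_on X z = n \<longrightarrow> z \<in> fst ` insert (x, y) S"
      by (metis fst_conv imageI insertI1)
    moreover have "Q (insert (x, y) S)" using QS x y by (simp add: Q_def)
    ultimately show ?thesis by blast
  next
    case False
    then show ?thesis using that by blast
  qed
  have f2: "\<exists>S'. Q S' \<and> S \<subseteq> S' \<and> (\<forall>y\<in>Y. to_nat_on Y y = n \<longrightarrow> y \<in> snd ` S')" if "Q S" for S n
  proof (cases "\<exists>y\<in>Y. to_nat_on Y y = n")
    case True
    then obtain y where y: "y \<in> Y" "to_nat_on Y y = n" by blast
    have QS: "finite S" "S \<subseteq> X \<times> Y" "coherent c S" using that by (simp_all add: Q_def)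
    obtain x where x: "x \<in> X" "coherent c (insert (x, y) S)"
      using backward[OF QS y(1)] by blast
    have "z = y" if "z \<in> Y" "to_nat_on Y z = n" for z
      using to_nat_on_inj[OF \<open>countable Y\<close> that(1) y(1)] that(2) y(2) by simp
    then have "\<forall>z\<in>Y. to_nat_on Y z = n \<longrightarrow> z \<in> snd ` insert (x, y) S"
      by (metis snd_conv imageI insertI1)
    moreover have "Q (insert (x, y) S)" using QS x y by (simp add: Q_def)
    ultimately show ?thesis by blast
  next
    case False
    then show ?thesis using that by blast
  qed
  have step: "\<exists>S'. Q S' \<and> (S \<subseteq> S' \<and> (\<forall>x\<in>X. to_nat_on X x = n \<longrightarrow> x \<in> fst ` S')
      \<and> (\<forall>y\<in>Y.  to_nat_on Y y = n \<longrightarrow> y \<in> snd ` S'))" if S: "Q S" for S n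
  proof -
    obtain S1 where S1: "Q S1" "S \<subseteq> S1" "\<forall>x\<in>X. to_nat_on X x = n \<longrightarrow> x \<in> fst ` S1"
      using f1[OF S, of n] by blast
    obtain S2 where S2: "Q S2" "S1 \<subseteq> S2" "\<forall>y\<in>Y. to_nat_on Y y = n \<longrightarrow> y \<in> snd ` S2"
      using f2[OF S1(1), of n] by blast
    have "S \<subseteq> S2" using S1(2) S2(2) by (rule subset_trans)
    moreover have "\<forall>x\<in>X. to_nat_on X x = n \<longrightarrow> x \<in> fst ` S2"
      using S1(3) image_mono[OF S2(2), of fst] by (meson subsetD)
    ultimately show ?thesis using S2(1,3) by (intro exI[of _ S2] conjI)
  qed
  \<comment> \<open>Stage \<open>n\<close> adds the element numbered \<open>n\<close> on either
    side, so the union of the stages is total and onto.\<close>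
  have "\<exists>S. \<forall>n. Q (S n) \<and> (S n \<subseteq> S (Suc n)
      \<and> (\<forall>x\<in>X. to_nat_on X x = n \<longrightarrow> x \<in> fst ` S (Suc n))
      \<and> (\<forall>y\<in>Y. to_nat_on Y y = n \<longrightarrow> y \<in> snd ` S (Suc n)))"
  proof (rule dependent_nat_choice)
    show "\<exists>S. Q S" by (rule exI[of _ "{}"]) (simp add: Q_def coherent_def)
  qed (rule step)
  then obtain S where S0: "\<forall>n. Q (S n) \<and> (S n \<subseteq> S (Suc n)
      \<and> (\<forall>x\<in>X. to_nat_on X x = n \<longrightarrow> x \<in> fst ` S (Suc n))
      \<and> (\<forall>y\<in>Y. to_nat_on Y y = n \<longrightarrow> y \<in> snd ` S (Suc n)))" ..
  have S: "Q (S n)" "S n \<subseteq> S (Suc n)"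
    "x \<in> X \<Longrightarrow> to_nat_on X x = n \<Longrightarrow> x \<in> fst ` S (Suc n)"
    "y \<in> Y \<Longrightarrow> to_nat_on Y y = n \<Longrightarrow> y \<in> snd ` S (Suc n)" for n x y
    using S0[rule_format, of n] by auto
  define U where "U = (\<Union>n. S n)"
  have mono: "S m \<subseteq> S n" if "m \<le> n" for m n
    using that S(2) by (rule lift_Suc_mono_le[rotated])
  have coh: "c x y x' y'" if "(x, y) \<in> U" "(x', y') \<in> U" for x y x' y'
  proof -
    obtain m n where "(x, y) \<in> S m" "(x', y') \<in> S n" using \<open>(x, y) \<in> U\<close> \<open>(x', y') \<in> U\<close> U_def by auto
    then have "(x, y) \<in> S (max m n)" "(x', y') \<in> S (max m n)"
      using mono[of m "max m n"] mono[of n "max m n"] by auto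
    then show ?thesis using S(1)[of "max m n"] unfolding Q_def coherent_def by auto
  qed
  have sub: "U \<subseteq> X \<times> Y" using S(1) unfolding U_def Q_def by blast
  have "\<exists>y. (x, y) \<in> U" if "x \<in> X" for x
    using S(3)[OF that refl] unfolding U_def by fastforce
  then obtain f where f: "\<And>x. x \<in> X \<Longrightarrow> (x, f x) \<in> U" by metis
  have sur: "\<exists>x\<in>X. f x = y" if y: "y \<in> Y" for y
  proof -
    obtain x where x: "(x, y) \<in> U" using S(4)[OF y refl] unfolding U_def by fastforce
    then have "x \<in> X" using sub by blast
    then have "f x = y" using eq[OF coh[OF f[OF \<open>x \<in> X\<close>] x]] by simp
    then show ?thesis using \<open>x \<in> X\<close> by blast
  qed
  have "bij_betw f X Y"
    unfolding bij_betw_def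
  proof
    show "inj_on f X"
    proof (rule inj_onI)
      show "x = x'" if "x \<in> X" "x' \<in> X" "f x = f x'" for x x'
        using eq[OF coh[OF f[OF that(1)] f[OF that(2)]]] that(3) by simp
    qed
    show "f ` X = Y" using sur f sub by blast
  qed
  then show ?thesis using coh f by blast
qed

definition same :: "('a \<Rightarrow> 'a \<Rightarrow> bool) \<Rightarrow> ('b \<Rightarrow> 'b \<Rightarrow> bool) \<Rightarrow> 'a \<Rightarrow> 'b \<Rightarrow> 'a \<Rightarrow> 'b \<Rightarrow> bool" where
  "same r s x y x' y' \<longleftrightarrow> (x = x' \<longleftrightarrow> y = y') \<and> (r x x' \<longleftrightarrow> s y y') \<and> (r x' x \<longleftrightarrow> s y' y)"

lemma same_sym: "same r s x y x' y' \<Longrightarrow> same r s x' y' x y"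
  by (auto simp: same_def)

section \<open>Isomorphisms and copies\<close>

lemma rel_iso_comp:
  assumes "rel_iso A r B s f" "rel_iso B s C t g"
  shows "rel_iso A r C t (g \<circ> f)"
proof -
  have "f x \<in> B" if "x \<in> A" for x using assms(1) that unfolding rel_iso_def bij_betw_def by blast
  then show ?thesis using assms unfolding rel_iso_def by (auto intro: bij_betw_trans)
qed

lemma rel_iso_inv:
  assumes "rel_iso A r B s f"
  shows "rel_iso B s A r (inv_into A f)"
proof -
  have b: "bij_betw f A B" using assms by (simp add: rel_iso_def)
  then have "inv_into A f y \<in> A" "f (inv_into A f y) = y" if "y \<in> B" for y
    using that by (metis bij_betw_def inv_into_into, metis bij_betw_inv_into_right)
  then show ?thesis using assms bij_betw_inv_into[OF b] unfolding rel_iso_def by auto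
qed

lemma rel_iso_restrict:
  assumes "rel_iso A r B s f" "C \<subseteq> A"
  shows "rel_iso C r (f ` C) s f"
  using assms inj_on_subset[of f A C] unfolding rel_iso_def bij_betw_def by auto

lemma isomorphic_sym: "isomorphic A r B s \<Longrightarrow> isomorphic B s A r"
  unfolding isomorphic_def using rel_iso_inv by blast

lemma isomorphic_trans: "isomorphic A r B s \<Longrightarrow> isomorphic B s C t \<Longrightarrow> isomorphic A r C t"
  unfolding isomorphic_def using rel_iso_comp by blast

lemma isomorphic_refl: "isomorphic A r A r"
  unfolding isomorphic_def rel_iso_def by (rule exI[of _ id]) simp

lemma copies_self: "X \<in> copies X r"
  by (simp add: copies_def isomorphic_refl)

text \<open>Carries a copy found in \<open>X\<close> into an arbitrary copy \<open>B\<close>, so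
  that shrinking arguments need only be made in \<open>X\<close>.\<close>

lemma copies_in_copy:
  assumes "rel_iso X r B r f" "B \<in> copies X r" "A \<in> copies X r"
  shows "f ` A \<in> copies X r" "f ` A \<subseteq> B"
proof -
  have "A \<subseteq> X" "isomorphic A r X r" "B \<subseteq> X" using assms by (auto simp: copies_def)
  moreover have "f ` X = B" using assms(1) by (auto simp: rel_iso_def bij_betw_def)
  ultimately show "f ` A \<subseteq> B" by blast
  have "isomorphic A r (f ` A) r"
    using rel_iso_restrict[OF assms(1) \<open>A \<subseteq> X\<close>] unfolding isomorphic_def by blast
  then show "f ` A \<in> copies X r"
    using \<open>f ` A \<subseteq> B\<close> \<open>B \<subseteq> X\<close> \<open>isomorphic A r X r\<close>
    unfolding copies_def by (auto intro: isomorphic_trans isomorphic_sym)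
qed

lemma copies_iso:
  assumes "B \<in> copies X r"
  obtains f where "rel_iso X r B r f"
  using assms isomorphic_sym unfolding copies_def isomorphic_def by blast

text \<open>Assuming that the relation holds only inside \<open>X\<close> removes all carrier side conditions; the
  general case follows by passing to the restricted relation, which has the same copies.\<close>

locale hposet =
  fixes X :: "'a set" and r :: "'a \<Rightarrow> 'a \<Rightarrow> bool" (infix \<open>\<sqsubset>\<close> 50)
  assumes fld: "x \<sqsubset> y \<Longrightarrow> x \<in> X \<and> y \<in> X"
    and irr: "\<not> x \<sqsubset> x"
    and tr: "x \<sqsubset> y \<Longrightarrow> y \<sqsubset> z \<Longrightarrow> x \<sqsubset> z"
    and hom: "ultrahomogeneous X r"
    and cX: "countable X" and iX: "infinite X"
begin

abbreviation incomp (infix \<open>\<bowtie>\<close> 50) where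
  "x \<bowtie> y \<equiv> x \<noteq> y \<and> \<not> x \<sqsubset> y \<and> \<not> y \<sqsubset> x"

abbreviation aut where "aut g \<equiv> rel_iso X r X r g"

lemma same_refl: "same r r x y x y"
  by (simp add: same_def irr)

lemma asym: "x \<sqsubset> y \<Longrightarrow> \<not> y \<sqsubset> x"
  using tr irr by blast

lemma autD:
  assumes "aut g" "x \<in> X"
  shows "g x \<in> X" "y \<in> X \<Longrightarrow> g x \<sqsubset> g y \<longleftrightarrow> x \<sqsubset> y" "y \<in> X \<Longrightarrow> g x = g y \<longleftrightarrow> x = y"
  using assms unfolding rel_iso_def bij_betw_def inj_on_def by auto

lemma aut_surj: "aut g \<Longrightarrow> y \<in> X \<Longrightarrow> \<exists>x\<in>X. g x = y"
  unfolding rel_iso_def bij_betw_def by (metis imageE)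

text \<open>For a finite relation, \<open>coherent (same r r)\<close> means being a finite partial
  isomorphism. Prescribing pairs is handier below than building a map between two sets.\<close>

lemma hom_rel:
  assumes "finite S" "S \<subseteq> X \<times> X" "coherent (same r r) S"
  shows "\<exists>g. aut g \<and> (\<forall>(x, y)\<in>S. g x = y)"
proof -
  have "\<forall>x\<in>fst ` S. \<exists>y. (x, y) \<in> S" by force
  then obtain f where f: "\<And>x. x \<in> fst ` S \<Longrightarrow> (x, f x) \<in> S" using bchoice by metis
  have c: "same r r x y x' y'" if "(x, y) \<in> S" "(x', y') \<in> S" for x y x' y'
    using assms(3) that unfolding coherent_def by blast
  have fe: "f x = y" if "(x, y) \<in> S" for x y
    using c[OF that f[of x]] that unfolding same_def by force
  have "rel_iso (fst ` S) r (snd ` S) r f"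
    unfolding rel_iso_def bij_betw_def
  proof (intro conjI ballI)
    show "inj_on f (fst ` S)" using f c unfolding same_def inj_on_def by blast
    show "f ` fst ` S = snd ` S"
      unfolding image_image by (rule image_cong) (use fe in auto)
    show "x \<sqsubset> y \<longleftrightarrow> f x \<sqsubset> f y" if "x \<in> fst ` S" "y \<in> fst ` S" for x y
      using f c that unfolding same_def by blast
  qed
  moreover have "fst ` S \<subseteq> X" "snd ` S \<subseteq> X" "finite (fst ` S)" "finite (snd ` S)"
    using assms by auto
  ultimately obtain g where g: "aut g" "\<forall>x\<in>fst ` S. g x = f x"
    using hom[unfolded ultrahomogeneous_def, rule_format, of "fst ` S" "snd ` S" f] by blast
  then have "\<forall>(x, y)\<in>S. g x = y" using fe by force
  then show ?thesis using g by blast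
qed

text \<open>Back and forth between \<open>A\<close> and \<open>X\<close>: the step into
  \<open>X\<close> is ultrahomogeneity alone, and the step back only asks that one-types over finite
  subsets of \<open>A\<close> be realized inside \<open>A\<close>.\<close>

lemma copy_criterion:
  assumes "A \<subseteq> X"
    and real: "\<And>F x. \<lbrakk>finite F; F \<subseteq> A; x \<in> X; x \<notin> F\<rbrakk>
      \<Longrightarrow> \<exists>y\<in>A. \<forall>z\<in>F. y \<noteq> z \<and> (y \<sqsubset> z \<longleftrightarrow> x \<sqsubset> z) \<and> (z \<sqsubset> y \<longleftrightarrow> z \<sqsubset> x)"
  shows "A \<in> copies X r"
proof -
  have ext: "\<exists>g. aut g \<and> (\<forall>(x, y)\<in>S. g x = y)"
    if "finite S" "S \<subseteq> A \<times> X" "coherent (same r r) S" for S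
    using hom_rel[of S] that assms(1) by auto
  have "\<exists>f. bij_betw f A X \<and> (\<forall>x\<in>A. \<forall>x'\<in>A. same r r x (f x) x' (f x'))"
  proof (rule back_and_forth)
    show "countable A" using assms(1) cX countable_subset by blast
    show "countable X" by (rule cX)
    show "same r r x y x' y' \<Longrightarrow> x = x' \<longleftrightarrow> y = y'" for x y x' y' by (simp add: same_def)
    fix S assume S: "finite S" "S \<subseteq> A \<times> X" "coherent (same r r) S"
    then obtain g where g: "aut g" "\<forall>(x, y)\<in>S. g x = y" using ext by blast
    have SX: "x \<in> X" if "(x, y) \<in> S" for x y using S(2) assms(1) that by auto
    show "\<exists>y\<in>X. coherent (same r r) (insert (x, y) S)" if "x \<in> A" for x
    proof
      have "x \<in> X" using that assms(1) by blast
      then show "g x \<in> X" using autD g by blast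
      have "same r r x (g x) x' y'" "same r r x' y' x (g x)" if "(x', y') \<in> S" for x' y'
        using g(2) that autD(2,3)[OF g(1)] \<open>x \<in> X\<close> SX[OF that] unfolding same_def by auto
      moreover have "same r r x (g x) x (g x)" by (simp add: same_def irr)
      ultimately show "coherent (same r r) (insert (x, g x) S)"
        using S(3) unfolding coherent_def by auto
    qed
    show "\<exists>x\<in>A. coherent (same r r) (insert (x, y) S)" if "y \<in> X" for y
    proof (cases "\<exists>x. (x, y) \<in> S")
      case True
      then obtain x where "(x, y) \<in> S" by blast
      then show ?thesis using S by (intro bexI[of _ x]) (auto simp: insert_absorb)
    next
      case False
      \<comment> \<open>The preimage of \<open>y\<close> under an automorphism extending
        \<open>S\<close> has over the domain of \<open>S\<close> the type that \<open>y\<close> has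
        over the range; \<open>real\<close> finds a point of \<open>A\<close> with this
        type.\<close>
      obtain x where x: "x \<in> X" "g x = y" using aut_surj[OF g(1) \<open>y \<in> X\<close>] by blast
      have "x \<notin> fst ` S" using False g(2) x(2) by auto
      moreover have "finite (fst ` S)" "fst ` S \<subseteq> A" using S by auto
      ultimately obtain z where z: "z \<in> A"
        "\<forall>w\<in>fst ` S. z \<noteq> w \<and> (z \<sqsubset> w \<longleftrightarrow> x \<sqsubset> w) \<and> (w \<sqsubset> z \<longleftrightarrow> w \<sqsubset> x)"
        using real[of "fst ` S" x] x(1) by blast
      have "same r r z y x' y'" "same r r x' y' z y" if "(x', y') \<in> S" for x' y'
      proof -
        have "x' \<in> fst ` S" using that by force
        then have "z \<noteq> x'" "x \<noteq> x'" "z \<sqsubset> x' \<longleftrightarrow> x \<sqsubset> x'" "x' \<sqsubset> z \<longleftrightarrow> x' \<sqsubset> x"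
          using z(2) \<open>x \<notin> fst ` S\<close> by auto
        moreover have "g x' = y'" using g(2) that by auto
        ultimately show "same r r z y x' y'" "same r r x' y' z y"
          using autD(2,3)[OF g(1)] x SX[OF that] unfolding same_def by auto
      qed
      moreover have "same r r z y z y" by (simp add: same_def irr)
      ultimately show ?thesis
        using S(3) z(1) unfolding coherent_def by (intro bexI[of _ z]) auto
    qed
  qed
  then show ?thesis
    using assms(1) unfolding copies_def isomorphic_def rel_iso_def same_def by blast
qed

text \<open>The fixed-size forms move a small picture onto points already given; the pairwise
  \<open>same\<close> conditions say that the two pictures match.\<close>

lemma hom2:
  assumes "same r r a a' b b'" "{a, a', b, b'} \<subseteq> X"
  obtains g where "aut g" "g a = a'" "g b = b'"
proof -
  have "\<exists>g. aut g \<and> (\<forall>(x, y)\<in>{(a, a'), (b, b')}. g x = y)"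
    using assms by (intro hom_rel) (simp_all add: coherent_def same_refl same_sym)
  then show ?thesis using that by auto
qed

lemma hom1:
  assumes "a \<in> X" "a' \<in> X"
  obtains g where "aut g" "g a = a'"
  using hom2[of a a' a a'] assms by (auto simp: same_def irr)

lemma hom3:
  assumes "same r r a a' b b'" "same r r a a' c c'" "same r r b b' c c'"
    "{a, a', b, b', c, c'} \<subseteq> X"
  obtains g where "aut g" "g a = a'" "g b = b'" "g c = c'"
proof -
  have "\<exists>g. aut g \<and> (\<forall>(x, y)\<in>{(a, a'), (b, b'), (c, c')}. g x = y)"
    using assms by (intro hom_rel) (simp_all add: coherent_def same_refl same_sym)
  then show ?thesis using that by auto
qed

lemma hom4:
  assumes "same r r a a' b b'" "same r r a a' c c'" "same r r a a' d d'"
    "same r r b b' c c'" "same r r b b' d d'" "same r r c c' d d'"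
    "{a, a', b, b', c, c', d, d'} \<subseteq> X"
  obtains g where "aut g" "g a = a'" "g b = b'" "g c = c'" "g d = d'"
proof -
  have "\<exists>g. aut g \<and> (\<forall>(x, y)\<in>{(a, a'), (b, b'), (c, c'), (d, d')}. g x = y)"
    using assms by (intro hom_rel) (simp_all add: coherent_def same_refl same_sym)
  then show ?thesis using that by auto
qed

text \<open>Reversing the order keeps the isomorphisms, so each upward statement yields its downward
  twin by interpretation.\<close>

lemma dual: "hposet X (\<lambda>x y. y \<sqsubset> x)"
proof
  have "rel_iso A (\<lambda>x y. y \<sqsubset> x) B (\<lambda>x y. y \<sqsubset> x) g \<longleftrightarrow> rel_iso A r B r g" for A B g
    unfolding rel_iso_def by blast
  then show "ultrahomogeneous X (\<lambda>x y. y \<sqsubset> x)"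
    using hom unfolding ultrahomogeneous_def by simp
  show "y \<sqsubset> x \<Longrightarrow> z \<sqsubset> y \<Longrightarrow> z \<sqsubset> x" for x y z by (rule tr)
qed (use fld irr cX iX in auto)

end

section \<open>Small configurations in directed orders\<close>

text \<open>Serves to force a point into a bounded region: bounds of \<open>F\<close> chosen freely
  are moved onto the prescribed ones while \<open>F\<close> stays fixed. For a single bound the two
  pairs coincide.\<close>

lemma (in hposet) hom_fix:
  assumes "finite F" "F \<subseteq> X" "u \<in> X" "d \<in> X" "u' \<in> X" "d' \<in> X"
    and "\<And>f. f \<in> F \<Longrightarrow> same r r f f u d" "\<And>f. f \<in> F \<Longrightarrow> same r r f f u' d'"
    and "same r r u d u' d'"
  obtains g where "aut g" "\<And>f. f \<in> F \<Longrightarrow> g f = f" "g u = d" "g u' = d'"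
proof -
  have id: "same r r f f f' f'" for f f' by (simp add: same_def)
  have "\<exists>g. aut g \<and> (\<forall>(x, y)\<in>(\<lambda>f. (f, f)) ` F \<union> {(u, d), (u', d')}. g x = y)"
    using assms
    by (intro hom_rel) (auto simp: coherent_def same_refl same_sym id)
  then show ?thesis using that by auto
qed

section \<open>Consequences of one comparable pair\<close>

locale hposet_ne = hposet +
  assumes ne: "\<exists>a b. a \<sqsubset> b"
begin

lemma dual_ne: "hposet_ne X (\<lambda>x y. y \<sqsubset> x)"
  using dual ne unfolding hposet_ne_def hposet_ne_axioms_def by blast

lemma above: "x \<in> X \<Longrightarrow> \<exists>y. x \<sqsubset> y"
proof -
  assume "x \<in> X"
  obtain a b where "a \<sqsubset> b" using ne by blast
  then have "a \<in> X" "b \<in> X" using fld by auto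
  then obtain g where "aut g" "g a = x" using hom1 \<open>x \<in> X\<close> by blast
  then have "x \<sqsubset> g b" using autD(2) \<open>a \<in> X\<close> \<open>b \<in> X\<close> \<open>a \<sqsubset> b\<close> by blast
  then show ?thesis by blast
qed

lemma below: "x \<in> X \<Longrightarrow> \<exists>y. y \<sqsubset> x"
proof -
  interpret d: hposet_ne X "\<lambda>x y. y \<sqsubset> x" by (rule dual_ne)
  show "x \<in> X \<Longrightarrow> \<exists>y. y \<sqsubset> x" by (rule d.above)
qed

text \<open>A point \<open>u\<close> above \<open>x\<close> looks to \<open>L\<close> just like
  \<open>x\<close>. The automorphism that fixes \<open>L\<close> and sends \<open>u\<close> to
  \<open>x\<close> drops \<open>x\<close> strictly below itself and keeps it above
  \<open>L\<close>.\<close>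

lemma between_left:
  assumes "finite L" "\<And>l. l \<in> L \<Longrightarrow> l \<sqsubset> x" "x \<in> X"
  shows "\<exists>a. a \<sqsubset> x \<and> (\<forall>l\<in>L. l \<sqsubset> a)"
proof -
  obtain u where u: "x \<sqsubset> u" using above assms(3) by blast
  then have "u \<in> X" using fld by blast
  have s: "same r r l l u x" if "l \<in> L" for l
    using assms(2)[OF that] u tr asym irr unfolding same_def by metis
  have "L \<subseteq> X" using assms(2) fld by blast
  obtain g where g: "aut g" "\<And>l. l \<in> L \<Longrightarrow> g l = l" "g u = x"
    using hom_fix[OF assms(1) \<open>L \<subseteq> X\<close> \<open>u \<in> X\<close> assms(3) \<open>u \<in> X\<close> assms(3) s s] same_refl
    by (metis irr same_def)
  have "g x \<sqsubset> x" using autD(2)[OF g(1) assms(3) \<open>u \<in> X\<close>] g(3) u by simp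
  moreover have "l \<sqsubset> g x" if "l \<in> L" for l
    using autD(2)[OF g(1) _ assms(3), of l] g(2)[OF that] assms(2)[OF that] \<open>L \<subseteq> X\<close> that by auto
  ultimately show ?thesis by blast
qed

lemma between_right:
  assumes "finite U" "\<And>u. u \<in> U \<Longrightarrow> x \<sqsubset> u" "x \<in> X"
  shows "\<exists>b. x \<sqsubset> b \<and> (\<forall>u\<in>U. b \<sqsubset> u)"
proof -
  interpret d: hposet_ne X "\<lambda>x y. y \<sqsubset> x" by (rule dual_ne)
  show ?thesis using d.between_left assms by blast
qed

lemma dense: "a \<sqsubset> b \<Longrightarrow> \<exists>c. a \<sqsubset> c \<and> c \<sqsubset> b"
  using between_left[of "{a}" b] fld by blast

end

section \<open>Orders directed both ways\<close>

locale hposet_dir = hposet_ne +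
  assumes up: "x \<in> X \<Longrightarrow> y \<in> X \<Longrightarrow> \<exists>u. x \<sqsubset> u \<and> y \<sqsubset> u"
    and down: "x \<in> X \<Longrightarrow> y \<in> X \<Longrightarrow> \<exists>u. u \<sqsubset> x \<and> u \<sqsubset> y"
begin

lemma dual_dir: "hposet_dir X (\<lambda>x y. y \<sqsubset> x)"
  using dual_ne up down unfolding hposet_dir_def hposet_dir_axioms_def by blast

lemma fin_up: "finite F \<Longrightarrow> F \<subseteq> X \<Longrightarrow> \<exists>u\<in>X. \<forall>f\<in>F. f \<sqsubset> u"
proof (induction F rule: finite_induct)
  case empty
  then show ?case using ne fld by blast
next
  case (insert x F)
  then obtain u where u: "u \<in> X" "\<forall>f\<in>F. f \<sqsubset> u" by auto
  obtain v where v: "x \<sqsubset> v" "u \<sqsubset> v" using up[of x u] u(1) insert.prems by blast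
  then have "\<forall>f\<in>insert x F. f \<sqsubset> v" using u tr by blast
  then show ?case using v fld by blast
qed

lemma fin_down: "finite F \<Longrightarrow> F \<subseteq> X \<Longrightarrow> \<exists>u\<in>X. \<forall>f\<in>F. u \<sqsubset> f"
proof -
  interpret d: hposet_dir X "\<lambda>x y. y \<sqsubset> x" by (rule dual_dir)
  show "finite F \<Longrightarrow> F \<subseteq> X \<Longrightarrow> \<exists>u\<in>X. \<forall>f\<in>F. u \<sqsubset> f" by (rule d.fin_up)
qed

text \<open>\<open>B\<close> is first moved above a bound \<open>u\<close> of \<open>A\<close>. As
  all of \<open>A\<close> lies below all of \<open>B\<close>, the set \<open>A\<close> with the
  moved \<open>B\<close> is the same picture as \<open>A\<close> with \<open>B\<close>, so the point
  \<open>u\<close> separating the former pulls back to one separating the latter.\<close>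

lemma interpolation:
  assumes "finite A" "finite B" "A \<subseteq> X" "B \<subseteq> X" "\<And>a b. a \<in> A \<Longrightarrow> b \<in> B \<Longrightarrow> a \<sqsubset> b"
  shows "\<exists>x\<in>X. (\<forall>a\<in>A. a \<sqsubset> x) \<and> (\<forall>b\<in>B. x \<sqsubset> b)"
proof -
  obtain u where u: "u \<in> X" "\<forall>a\<in>A. a \<sqsubset> u" using fin_up[OF assms(1,3)] by blast
  obtain l where l: "l \<in> X" "\<forall>b\<in>B. l \<sqsubset> b" using fin_down[OF assms(2,4)] by blast
  obtain g where g: "aut g" "g l = u" using hom1[OF l(1) u(1)] by blast
  have gB: "g b \<in> X" "u \<sqsubset> g b" if "b \<in> B" for b
  proof -
    have "b \<in> X" using that assms(4) by blast
    then show "g b \<in> X" "u \<sqsubset> g b"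
      using autD(1)[OF g(1), of b] autD(2)[OF g(1) l(1), of b] g(2) l(2) that by auto
  qed
  define S where "S = (\<lambda>a. (a, a)) ` A \<union> (\<lambda>b. (b, g b)) ` B"
  have "coherent (same r r) S"
  proof -
    have "same r r a a a' a'" for a a' by (simp add: same_def)
    moreover have "same r r b (g b) b' (g b')" if "b \<in> B" "b' \<in> B" for b b'
      using that autD[OF g(1)] assms(4) unfolding same_def by blast
    moreover have "same r r a a b (g b)" if "a \<in> A" "b \<in> B" for a b
      using assms(5)[OF that] gB(2)[OF that(2)] u(2) that(1) tr asym irr unfolding same_def by metis
    ultimately show ?thesis unfolding S_def coherent_def by (auto simp: same_sym)
  qed
  moreover have "finite S" "S \<subseteq> X \<times> X" using assms gB unfolding S_def by auto
  ultimately obtain h where h: "aut h" "\<forall>(x, y)\<in>S. h x = y" using hom_rel[of S] by auto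
  have hA: "h a = a" if "a \<in> A" for a
    using bspec[OF h(2), of "(a, a)"] that unfolding S_def by auto
  have hB: "h b = g b" if "b \<in> B" for b
    using bspec[OF h(2), of "(b, g b)"] that unfolding S_def by auto
  obtain x where x: "x \<in> X" "h x = u" using aut_surj[OF h(1) u(1)] by blast
  have "a \<sqsubset> x" if "a \<in> A" for a
    using autD(2)[OF h(1) _ x(1), of a] x(2) hA[OF that] u(2) that assms(3) by auto
  moreover have "x \<sqsubset> b" if "b \<in> B" for b
    using autD(2)[OF h(1) x(1), of b] x(2) hB[OF that] gB[OF that] that assms(4) by auto
  ultimately show ?thesis using x(1) by blast
qed

text \<open>A common upper bound of \<open>x\<close> and a finite \<open>F\<close> below
  \<open>d\<close> can be moved onto \<open>d\<close> with \<open>F\<close> fixed; the image of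
  \<open>x\<close> keeps the type of \<open>x\<close> over \<open>F\<close> and lies below
  \<open>d\<close>.\<close>

lemma down_set_copy:
  assumes "d \<in> X"
  shows "{x. x \<sqsubset> d} \<in> copies X r"
proof (rule copy_criterion)
  show "{x. x \<sqsubset> d} \<subseteq> X" using fld by blast
  fix F x assume F: "finite F" "F \<subseteq> {x. x \<sqsubset> d}" "x \<in> X" "x \<notin> F"
  then have "F \<subseteq> X" using fld by blast
  then obtain u where u: "u \<in> X" "\<forall>f\<in>insert x F. f \<sqsubset> u" using fin_up[of "insert x F"] F by blast
  have s: "same r r f f u d" if "f \<in> F" for f
    using that F(2) u(2) asym irr unfolding same_def by blast
  obtain g where g: "aut g" "\<And>f. f \<in> F \<Longrightarrow> g f = f" "g u = d"
    using hom_fix[OF F(1) \<open>F \<subseteq> X\<close> u(1) assms u(1) assms s s same_refl] by blast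
  have "g x \<sqsubset> d" using autD(2)[OF g(1) F(3) u(1)] g(3) u(2) by simp
  moreover have "g x \<noteq> z \<and> (g x \<sqsubset> z \<longleftrightarrow> x \<sqsubset> z) \<and> (z \<sqsubset> g x \<longleftrightarrow> z \<sqsubset> x)" if "z \<in> F" for z
  proof -
    have "z \<in> X" using that \<open>F \<subseteq> X\<close> by blast
    then show ?thesis
      using autD(2,3)[OF g(1) F(3), of z] autD(2)[OF g(1) _ F(3), of z] g(2)[OF that] that F(4) by auto
  qed
  ultimately show "\<exists>y\<in>{x. x \<sqsubset> d}. \<forall>z\<in>F. y \<noteq> z \<and> (y \<sqsubset> z \<longleftrightarrow> x \<sqsubset> z) \<and> (z \<sqsubset> y \<longleftrightarrow> z \<sqsubset> x)"
    by blast
qed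

lemma interval_copy:
  assumes "d \<sqsubset> e"
  shows "{x. d \<sqsubset> x \<and> x \<sqsubset> e} \<in> copies X r"
proof (rule copy_criterion)
  have de: "d \<in> X" "e \<in> X" using assms fld by auto
  show "{x. d \<sqsubset> x \<and> x \<sqsubset> e} \<subseteq> X" using fld by blast
  fix F x assume F: "finite F" "F \<subseteq> {x. d \<sqsubset> x \<and> x \<sqsubset> e}" "x \<in> X" "x \<notin> F"
  then have "F \<subseteq> X" using fld by blast
  then obtain u where u: "u \<in> X" "\<forall>f\<in>insert x F. f \<sqsubset> u" using fin_up[of "insert x F"] F by blast
  obtain l where l: "l \<in> X" "\<forall>f\<in>insert x F. l \<sqsubset> f"
    using fin_down[of "insert x F"] F \<open>F \<subseteq> X\<close> by blast
  have s: "same r r f f u e" "same r r f f l d" if "f \<in> F" for f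
    using that F(2) u(2) l(2) asym irr unfolding same_def by blast+
  \<comment> \<open>The two bounds are related like \<open>d\<close> and \<open>e\<close>, so both
    can be moved at the same time.\<close>
  have "l \<sqsubset> u" using u l tr by blast
  then have "same r r u e l d" using assms asym irr unfolding same_def by blast
  then obtain g where g: "aut g" "\<And>f. f \<in> F \<Longrightarrow> g f = f" "g u = e" "g l = d"
    using hom_fix[OF F(1) \<open>F \<subseteq> X\<close> u(1) de(2) l(1) de(1) s] by blast
  have "g x \<sqsubset> e" "d \<sqsubset> g x"
    using autD(2)[OF g(1) F(3) u(1)] autD(2)[OF g(1) l(1) F(3)] g(3,4) u(2) l(2) by simp_all
  moreover have "g x \<noteq> z \<and> (g x \<sqsubset> z \<longleftrightarrow> x \<sqsubset> z) \<and> (z \<sqsubset> g x \<longleftrightarrow> z \<sqsubset> x)" if "z \<in> F" for z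
  proof -
    have "z \<in> X" using that \<open>F \<subseteq> X\<close> by blast
    then show ?thesis
      using autD(2,3)[OF g(1) F(3), of z] autD(2)[OF g(1) _ F(3), of z] g(2)[OF that] that F(4) by auto
  qed
  ultimately show "\<exists>y\<in>{x. d \<sqsubset> x \<and> x \<sqsubset> e}.
      \<forall>z\<in>F. y \<noteq> z \<and> (y \<sqsubset> z \<longleftrightarrow> x \<sqsubset> z) \<and> (z \<sqsubset> y \<longleftrightarrow> z \<sqsubset> x)"
    by blast
qed

end

section \<open>Directed orders with a point beside a two-element chain\<close>

locale hposet_gen = hposet_dir +
  assumes onetwo: "\<exists>p q s. {p, q, s} \<subseteq> X \<and> p \<bowtie> q \<and> p \<bowtie> s \<and> q \<sqsubset> s"
begin

lemma dual_gen: "hposet_gen X (\<lambda>x y. y \<sqsubset> x)"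
proof -
  obtain p q s where "{p, q, s} \<subseteq> X" "p \<bowtie> q" "p \<bowtie> s" "q \<sqsubset> s" using onetwo by blast
  then have "\<exists>p q s. {p, q, s} \<subseteq> X \<and> (p \<noteq> q \<and> \<not> q \<sqsubset> p \<and> \<not> p \<sqsubset> q) \<and> (p \<noteq> s \<and> \<not> s \<sqsubset> p \<and> \<not> p \<sqsubset> s) \<and> s \<sqsubset> q"
    by (intro exI[of _ p] exI[of _ s] exI[of _ q]) auto
  then show ?thesis
    using dual_dir unfolding hposet_gen_def hposet_gen_axioms_def by blast
qed

text \<open>A common upper bound of the point and the chain extends the chain to three elements,
  which are moved onto \<open>a\<close>, \<open>b\<close>, \<open>c\<close>.\<close>

lemma onetwo_chain:
  assumes "a \<sqsubset> b" "b \<sqsubset> c"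
  shows "\<exists>x. x \<sqsubset> c \<and> x \<bowtie> a \<and> x \<bowtie> b"
proof -
  obtain p q s where p: "{p, q, s} \<subseteq> X" "p \<bowtie> q" "p \<bowtie> s" "q \<sqsubset> s" using onetwo by blast
  obtain u where u: "p \<sqsubset> u" "s \<sqsubset> u" using up[of p s] p(1) by blast
  have "same r r q a s b" "same r r q a u c" "same r r s b u c"
    using assms p(4) u(2) asym irr tr unfolding same_def by metis+
  moreover have X: "{q, a, s, b, u, c} \<subseteq> X" using fld assms p(1) u by blast
  ultimately obtain g where g: "aut g" "g q = a" "g s = b" "g u = c" using hom3[of q a s b u c] by auto
  have "g p \<sqsubset> c" "g p \<bowtie> a" "g p \<bowtie> b"
    using p u autD[OF g(1)] X g(2-4) by auto
  then show ?thesis by blast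
qed

text \<open>Start from \<open>p\<close> beside the chain \<open>q\<close>, \<open>s\<close> and take
  \<open>d\<close> below \<open>p\<close> and \<open>s\<close>. The fourth corner \<open>e\<close>
  is \<open>q\<close> itself if \<open>d\<close> is incomparable to it; otherwise it comes from
  \<open>onetwo_chain\<close> applied to \<open>d\<close>, \<open>q\<close>,
  \<open>s\<close>.\<close>

lemma N_poset: "\<exists>d a c e. d \<sqsubset> a \<and> d \<sqsubset> c \<and> e \<sqsubset> c \<and> a \<bowtie> c \<and> a \<bowtie> e \<and> d \<bowtie> e"
proof -
  obtain p q s where p: "{p, q, s} \<subseteq> X" "p \<bowtie> q" "p \<bowtie> s" "q \<sqsubset> s" using onetwo by blast
  obtain d where d: "d \<sqsubset> p" "d \<sqsubset> s" using down[of p s] p(1) by blast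
  show ?thesis
  proof (cases "d \<bowtie> q")
    case True
    then show ?thesis using p d by blast
  next
    case False
    then have "d \<sqsubset> q" using d(1) p(2) tr by blast
    then obtain e where e: "e \<sqsubset> s" "e \<bowtie> d" "e \<bowtie> q" using onetwo_chain p(4) by blast
    show ?thesis
    proof (cases "e \<bowtie> p")
      case True
      then show ?thesis using p d e by blast
    next
      case False
      then have "e \<sqsubset> p" using e(1) p(3) tr by blast
      then show ?thesis using p e by blast
    qed
  qed
qed

text \<open>An automorphism fixing the top \<open>c\<close> exchanges the two lower points of the N.
  The image of \<open>a\<close> is incomparable to \<open>a\<close>, because otherwise
  \<open>d\<close> would lie below that image or \<open>e\<close> below \<open>a\<close>.\<close>

lemma antichain3: "\<exists>a b c. {a, b, c} \<subseteq> X \<and> a \<bowtie> b \<and> a \<bowtie> c \<and> b \<bowtie> c"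
proof -
  obtain d a c e where N: "d \<sqsubset> a" "d \<sqsubset> c" "e \<sqsubset> c" "a \<bowtie> c" "a \<bowtie> e" "d \<bowtie> e"
    using N_poset by blast
  have X: "{d, e, c, a} \<subseteq> X" using N fld by blast
  have "same r r d e e d" "same r r d e c c" "same r r e d c c"
    using N asym irr unfolding same_def by metis+
  then obtain g where g: "aut g" "g d = e" "g e = d" "g c = c" using hom3[of d e e d c c] X by auto
  have "e \<sqsubset> g a" "g a \<bowtie> c" "g a \<bowtie> d"
    using N X autD[OF g(1)] g(2-4) by (metis insert_subset)+
  moreover have "a \<bowtie> g a" using N calculation tr[of d a "g a"] tr[of e "g a" a] by auto
  moreover have "g a \<in> X" using autD(1)[OF g(1)] X by blast
  ultimately show ?thesis
    using N(4) X by (intro exI[of _ a] exI[of _ "g a"] exI[of _ c]) auto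
qed

text \<open>Two members of a three-element antichain are moved onto the lower points
  \<open>d\<close>, \<open>e\<close> of an N, and the third becomes \<open>f\<close>. Wherever
  \<open>f\<close> falls, one of \<open>f\<close>, \<open>e\<close>, \<open>a\<close> is isolated
  beside some wedge.\<close>

lemma wedge_plus_point:
  "\<exists>a b x f. a \<sqsubset> x \<and> b \<sqsubset> x \<and> f \<in> X \<and> a \<bowtie> b \<and> f \<bowtie> a \<and> f \<bowtie> b \<and> f \<bowtie> x"
proof -
  obtain d a c e where N: "d \<sqsubset> a" "d \<sqsubset> c" "e \<sqsubset> c" "a \<bowtie> c" "a \<bowtie> e" "d \<bowtie> e"
    using N_poset by blast
  have X: "{d, e, c, a} \<subseteq> X" using N fld by blast
  obtain i j k where i: "{i, j, k} \<subseteq> X" "i \<bowtie> j" "i \<bowtie> k" "j \<bowtie> k" using antichain3 by blast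
  have "same r r i d j e" using i N unfolding same_def by blast
  then obtain g where g: "aut g" "g i = d" "g j = e" using hom2[of i d j e] X i(1) by auto
  define f where "f = g k"
  have f: "f \<in> X" "f \<bowtie> d" "f \<bowtie> e"
    using i autD[OF g(1)] g(2,3) unfolding f_def by (metis insert_subset)+
  show ?thesis
  proof (cases "f \<sqsubset> c")
    case False
    then have "f \<bowtie> c" using N f tr by blast
    then show ?thesis using N f by blast
  next
    case fc: True
    show ?thesis
    proof (cases "f \<sqsubset> a")
      case True
      then show ?thesis using N f X
        by (intro exI[of _ d] exI[of _ f] exI[of _ a] exI[of _ e]) auto
    next
      case False
      then have "a \<bowtie> f" using N f tr by blast
      then show ?thesis using N f X fc
        by (intro exI[of _ e] exI[of _ f] exI[of _ c] exI[of _ a]) auto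
    qed
  qed
qed

lemma vee_plus_point:
  "\<exists>a b x f. x \<sqsubset> a \<and> x \<sqsubset> b \<and> f \<in> X \<and> a \<bowtie> b \<and> f \<bowtie> a \<and> f \<bowtie> b \<and> f \<bowtie> x"
proof -
  interpret d: hposet_gen X "\<lambda>x y. y \<sqsubset> x" by (rule dual_gen)
  show ?thesis using d.wedge_plus_point by blast
qed

end

section \<open>The extension property\<close>

context hposet_gen
begin

text \<open>The position of \<open>a\<close> and \<open>b\<close> relative to \<open>c\<close>
  selects the picture to transport: the point beside a chain, the N, or the wedge with an isolated
  point. If both lie below \<open>c\<close>, interpolation under \<open>c\<close> and
  \<open>y\<close> suffices.\<close>

lemma upper_bound_avoiding_below:
  assumes "a \<sqsubset> y" "b \<sqsubset> y" "c \<sqsubset> y" "c \<noteq> a" "\<not> c \<sqsubset> a" "c \<noteq> b" "\<not> c \<sqsubset> b"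
  shows "\<exists>x. a \<sqsubset> x \<and> b \<sqsubset> x \<and> x \<sqsubset> y \<and> c \<noteq> x \<and> \<not> c \<sqsubset> x"
proof -
  have X: "{a, b, c, y} \<subseteq> X" using assms fld by blast
  have single: "\<exists>x. b' \<sqsubset> x \<and> x \<sqsubset> y \<and> c \<noteq> x \<and> \<not> c \<sqsubset> x" if b': "b' \<bowtie> c" "b' \<sqsubset> y" for b'
  proof -
    obtain p q s where p: "{p, q, s} \<subseteq> X" "p \<bowtie> q" "p \<bowtie> s" "q \<sqsubset> s" using onetwo by blast
    obtain u where u: "p \<sqsubset> u" "s \<sqsubset> u" using up[of p s] p(1) by blast
    have X': "{q, b', p, c, u, y} \<subseteq> X" using p u X that fld by blast
    have "q \<sqsubset> u" using p u tr by blast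
    then have "same r r q b' p c" "same r r q b' u y" "same r r p c u y"
      using that p u assms(3) asym irr unfolding same_def by metis+
    then obtain g where g: "aut g" "g q = b'" "g p = c" "g u = y"
      using hom3[of q b' p c u y] X' by auto
    have "b' \<sqsubset> g s" "g s \<sqsubset> y" "g s \<bowtie> c"
      using p u X' autD[OF g(1)] g(2-4) by (metis insert_subset)+
    then show ?thesis by blast
  qed
  have mixed: "\<exists>x. a' \<sqsubset> x \<and> b' \<sqsubset> x \<and> x \<sqsubset> y \<and> c \<noteq> x \<and> \<not> c \<sqsubset> x"
    if "a' \<bowtie> b'" "a' \<sqsubset> c" "b' \<bowtie> c" "a' \<sqsubset> y" "b' \<sqsubset> y" for a' b'
  proof -
    obtain d v z e where N: "d \<sqsubset> v" "d \<sqsubset> z" "e \<sqsubset> z" "v \<bowtie> z" "v \<bowtie> e" "d \<bowtie> e"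
      using N_poset by blast
    then obtain u where u: "v \<sqsubset> u" "z \<sqsubset> u" using up[of v z] fld by blast
    have X': "{d, a', e, b', v, c, u, y, z} \<subseteq> X" using N u that fld by blast
    have "d \<sqsubset> u" "e \<sqsubset> u" using N u tr by blast+
    then have "same r r d a' e b'" "same r r d a' v c" "same r r d a' u y"
        "same r r e b' v c" "same r r e b' u y" "same r r v c u y"
      using that N u assms(3) asym irr unfolding same_def by metis+
    then obtain g where g: "aut g" "g d = a'" "g e = b'" "g v = c" "g u = y"
      using hom4[of d a' e b' v c u y] X' by auto
    have "a' \<sqsubset> g z" "b' \<sqsubset> g z" "g z \<sqsubset> y" "g z \<bowtie> c"
      using N u X' autD[OF g(1)] g(2-5) by (metis insert_subset)+
    then show ?thesis by blast
  qed
  have free: "\<exists>x. a \<sqsubset> x \<and> b \<sqsubset> x \<and> x \<sqsubset> y \<and> c \<noteq> x \<and> \<not> c \<sqsubset> x"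
    if "a \<bowtie> b" "a \<bowtie> c" "b \<bowtie> c"
  proof -
    obtain d e z v where N: "d \<sqsubset> z" "e \<sqsubset> z" "v \<in> X" "d \<bowtie> e" "v \<bowtie> d" "v \<bowtie> e" "v \<bowtie> z"
      using wedge_plus_point by blast
    then obtain u where u: "v \<sqsubset> u" "z \<sqsubset> u" using up[of v z] fld by blast
    have X': "{d, a, e, b, v, c, u, y, z} \<subseteq> X" using N u X fld by blast
    have "d \<sqsubset> u" "e \<sqsubset> u" using N u tr by blast+
    then have "same r r d a e b" "same r r d a v c" "same r r d a u y"
        "same r r e b v c" "same r r e b u y" "same r r v c u y"
      using that N u assms(1-3) asym irr unfolding same_def by metis+
    then obtain g where g: "aut g" "g d = a" "g e = b" "g v = c" "g u = y"
      using hom4[of d a e b v c u y] X' by auto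
    have "a \<sqsubset> g z" "b \<sqsubset> g z" "g z \<sqsubset> y" "g z \<bowtie> c"
      using N u X' autD[OF g(1)] g(2-5) by (metis insert_subset)+
    then show ?thesis by blast
  qed
  \<comment> \<open>Neither \<open>a\<close> nor \<open>b\<close> lies at or above \<open>c\<close>.
    If they are comparable and the larger is incomparable to \<open>c\<close>, that one alone
    matters.\<close>
  consider "a \<sqsubset> c" "b \<sqsubset> c" | "a = b" "a \<bowtie> c" | "a \<sqsubset> b" "b \<bowtie> c" | "b \<sqsubset> a" "a \<bowtie> c"
    | "a \<bowtie> b" "a \<sqsubset> c" "b \<bowtie> c" | "a \<bowtie> b" "b \<sqsubset> c" "a \<bowtie> c" | "a \<bowtie> b" "a \<bowtie> c" "b \<bowtie> c"
    using assms tr by metis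
  then show ?thesis
  proof cases
    case 1
    then obtain x where "x \<in> X" "\<forall>a\<in>{a, b}. a \<sqsubset> x" "\<forall>b\<in>{y, c}. x \<sqsubset> b"
      using interpolation[of "{a, b}" "{y, c}"] assms X by auto
    then show ?thesis using asym irr by blast
  next
    case 2
    then show ?thesis using single[of a] assms by blast
  next
    case 3
    then show ?thesis using single[of b] assms tr by blast
  next
    case 4
    then show ?thesis using single[of a] assms tr by blast
  next
    case 5
    then show ?thesis using mixed[of a b] assms by blast
  next
    case 6
    then show ?thesis using mixed[of b a] assms by blast
  next
    case 7
    then show ?thesis using free by blast
  qed
qed

lemma upper_bound_not_above:
  assumes "finite A" "finite B" "A \<subseteq> X" "B \<subseteq> X" "c \<in> X"
    and "\<And>a b. a \<in> A \<Longrightarrow> b \<in> B \<Longrightarrow> a \<sqsubset> b" "\<And>a. a \<in> A \<Longrightarrow> c \<noteq> a \<and> \<not> c \<sqsubset> a"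
  shows "\<exists>x\<in>X. (\<forall>a\<in>A. a \<sqsubset> x) \<and> (\<forall>b\<in>B. x \<sqsubset> b) \<and> c \<noteq> x \<and> \<not> c \<sqsubset> x"
  using assms(1,3,6,7)
proof (induction A rule: finite_induct)
  case empty
  obtain x where "x \<in> X" "\<forall>b\<in>insert c B. x \<sqsubset> b"
    using fin_down[of "insert c B"] assms(2,4,5) by auto
  then show ?case using asym irr by blast
next
  case (insert a A)
  then obtain x where x: "x \<in> X" "\<forall>a\<in>A. a \<sqsubset> x" "\<forall>b\<in>B. x \<sqsubset> b" "c \<noteq> x" "\<not> c \<sqsubset> x" by auto
  have ac: "c \<noteq> a" "\<not> c \<sqsubset> a" "a \<in> X" "\<forall>b\<in>B. a \<sqsubset> b" using insert.prems by auto
  obtain y where y: "y \<in> X" "a \<sqsubset> y" "x \<sqsubset> y" "\<forall>b\<in>B. y \<sqsubset> b"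
    using interpolation[of "{a, x}" B] x ac assms(2,4) by auto
  \<comment> \<open>\<open>y\<close> is a bound as wanted except that it may lie at or above
    \<open>c\<close>. It is then lowered towards \<open>a\<close> and \<open>x\<close>, so it stays
    below \<open>B\<close>.\<close>
  obtain z where z: "a \<sqsubset> z" "x \<sqsubset> z" "z \<sqsubset> y \<or> z = y" "c \<noteq> z" "\<not> c \<sqsubset> z"
  proof (cases "c \<sqsubset> y")
    case True
    then show ?thesis using upper_bound_avoiding_below[of a y x c] y x ac that by blast
  next
    case False
    show ?thesis
    proof (cases "c = y")
      case True
      obtain z where "a \<sqsubset> z" "x \<sqsubset> z" "z \<sqsubset> y"
        using between_left[of "{a, x}" y] y by auto
      then show ?thesis using that[of z] True irr asym by blast
    next
      case False
      then show ?thesis using that[of y] y \<open>\<not> c \<sqsubset> y\<close> by blast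
    qed
  qed
  then have "\<forall>b\<in>B. z \<sqsubset> b" using y(4) tr by blast
  moreover have "\<forall>a\<in>insert a A. a \<sqsubset> z" using x(2) z(1,2) tr by blast
  moreover have "z \<in> X" using z(1) fld by blast
  ultimately show ?case using z(4,5) by blast
qed

lemma lower_bound_not_below:
  assumes "finite A" "finite B" "A \<subseteq> X" "B \<subseteq> X" "c \<in> X"
    and "\<And>a b. a \<in> A \<Longrightarrow> b \<in> B \<Longrightarrow> a \<sqsubset> b" "\<And>b. b \<in> B \<Longrightarrow> c \<noteq> b \<and> \<not> b \<sqsubset> c"
  shows "\<exists>x\<in>X. (\<forall>a\<in>A. a \<sqsubset> x) \<and> (\<forall>b\<in>B. x \<sqsubset> b) \<and> c \<noteq> x \<and> \<not> x \<sqsubset> c"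
proof -
  interpret d: hposet_gen X "\<lambda>x y. y \<sqsubset> x" by (rule dual_gen)
  show ?thesis using d.upper_bound_not_above[of B A c] assms by blast
qed

text \<open>Raises \<open>x\<close> just enough to leave the region below \<open>c\<close>. Points
  of \<open>C\<close> enter one at a time: each correction lies between \<open>x\<close> and the
  earlier choice, and whatever lies between two points incomparable to some \<open>c'\<close> is
  incomparable to it too.\<close>

lemma move_up:
  assumes "finite B" "x \<sqsubset> c" "\<And>b. b \<in> B \<Longrightarrow> x \<sqsubset> b" "\<And>b. b \<in> B \<Longrightarrow> c \<noteq> b \<and> \<not> b \<sqsubset> c"
    and "finite C" "C \<subseteq> X" "\<And>c. c \<in> C \<Longrightarrow> x \<bowtie> c"
  shows "\<exists>y. x \<sqsubset> y \<and> (\<forall>b\<in>B. y \<sqsubset> b) \<and> y \<bowtie> c \<and> (\<forall>c\<in>C. y \<bowtie> c)"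
  using assms(5-7)
proof (induction C rule: finite_induct)
  case empty
  have X: "x \<in> X" "c \<in> X" "B \<subseteq> X" using assms(2,3) fld by auto
  obtain y where y: "x \<sqsubset> y" "\<forall>b\<in>B. y \<sqsubset> b" "c \<noteq> y" "\<not> y \<sqsubset> c"
    using lower_bound_not_below[of "{x}" B c] X assms by auto
  show ?case
  proof (cases "c \<sqsubset> y")
    case True
    \<comment> \<open>If \<open>y\<close> overshoots \<open>c\<close>, a vee with a bound of its
      arms is moved so that one arm lands on \<open>c\<close> and the bound on \<open>y\<close>; the
      other arm avoids \<open>c\<close>.\<close>
    obtain p q s v where p: "s \<sqsubset> p" "s \<sqsubset> q" "p \<bowtie> q"
      using vee_plus_point by blast
    then obtain u where u: "p \<sqsubset> u" "q \<sqsubset> u" using up[of p q] fld by blast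
    have X': "{s, x, p, c, u, y, q} \<subseteq> X" using p u True assms(2) fld by blast
    have "s \<sqsubset> u" "x \<sqsubset> y" using p u True assms(2) tr by blast+
    then have "same r r s x p c" "same r r s x u y" "same r r p c u y"
      using p u True assms(2) asym irr unfolding same_def by metis+
    then obtain g where g: "aut g" "g s = x" "g p = c" "g u = y"
      using hom3[of s x p c u y] X' by auto
    have "x \<sqsubset> g q" "g q \<sqsubset> y" "g q \<bowtie> c"
      using p u X' autD[OF g(1)] g(2-4) by (metis insert_subset)+
    then show ?thesis using y(2) tr by blast
  qed (use y in blast)
next
  case (insert k C)
  then obtain y where y: "x \<sqsubset> y" "\<forall>b\<in>B. y \<sqsubset> b" "y \<bowtie> c" "\<forall>c\<in>C. y \<bowtie> c" by auto
  have k: "x \<bowtie> k" "k \<in> X" using insert.prems by auto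
  have X: "{x, c, y, k} \<subseteq> X" using y assms(2) k(2) fld by blast
  obtain z where z: "x \<sqsubset> z" "z \<sqsubset> y \<or> z = y" "z \<bowtie> c" "z \<bowtie> k"
  proof (cases "k \<sqsubset> y")
    case False
    then have "y \<bowtie> k" using y(1) k tr by blast
    then show ?thesis using that[of y] y by blast
  next
    case ky: True
    \<comment> \<open>The points \<open>d\<close>, \<open>e\<close>, \<open>w\<close>,
      \<open>u\<close> are placed on \<open>x\<close>, \<open>k\<close>, \<open>c\<close>,
      \<open>y\<close>, and the image of \<open>v\<close> is the new point. Whether \<open>k\<close>
      lies below \<open>c\<close> decides between the N and the vee with an isolated point, each
      completed by a bound \<open>u\<close> of \<open>v\<close> and \<open>e\<close> that is not
      above \<open>w\<close>.\<close>
    have goal: thesis if "d \<sqsubset> v" "d \<sqsubset> w" "d \<bowtie> e" "e \<sqsubset> u" "v \<bowtie> w" "v \<bowtie> e" "v \<sqsubset> u" "w \<bowtie> u"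
      "e \<sqsubset> w \<longleftrightarrow> k \<sqsubset> c" "\<not> w \<sqsubset> e" "e \<noteq> w" for d v w e u
    proof -
      have X': "{d, x, e, k, w, c, u, y, v} \<subseteq> X" using that ky X fld by blast
      have kc: "\<not> c \<sqsubset> k" "k \<noteq> c" using assms(2) k(1) tr by blast+
      have "d \<sqsubset> u" using that tr by blast
      then have "same r r d x e k" "same r r d x w c" "same r r d x u y"
          "same r r e k w c" "same r r e k u y" "same r r w c u y"
        using that y(1,3) k(1) ky kc assms(2) asym irr unfolding same_def by metis+
      then obtain g where g: "aut g" "g d = x" "g e = k" "g w = c" "g u = y"
        using hom4[of d x e k w c u y] X' by auto
      have "x \<sqsubset> g v" "g v \<sqsubset> y" "g v \<bowtie> c" "g v \<bowtie> k"
        using that X' autD[OF g(1)] g(2-5) by (metis insert_subset)+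
      then show ?thesis using \<open>\<And>z. x \<sqsubset> z \<Longrightarrow> z \<sqsubset> y \<or> z = y \<Longrightarrow> z \<bowtie> c \<Longrightarrow> z \<bowtie> k \<Longrightarrow> thesis\<close> by blast
    qed
    show ?thesis
    proof (cases "k \<sqsubset> c")
      case True
      obtain d v w e where N: "d \<sqsubset> v" "d \<sqsubset> w" "e \<sqsubset> w" "v \<bowtie> w" "v \<bowtie> e" "d \<bowtie> e"
        using N_poset by blast
      have XN: "v \<in> X" "e \<in> X" "w \<in> X" using N fld by blast+
      obtain u where u: "v \<sqsubset> u" "e \<sqsubset> u" "w \<noteq> u" "\<not> w \<sqsubset> u"
        using upper_bound_not_above[of "{v, e}" "{}" w] N XN asym irr by auto
      have "w \<bowtie> u" using u N tr by blast
      then show ?thesis using goal[of d v w e u] N u True asym irr by blast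
    next
      case False
      obtain w v d e where N: "d \<sqsubset> w" "d \<sqsubset> v" "e \<in> X" "w \<bowtie> v" "e \<bowtie> w" "e \<bowtie> v" "e \<bowtie> d"
        using vee_plus_point by blast
      have XN: "v \<in> X" "w \<in> X" using N fld by blast+
      obtain u where u: "v \<sqsubset> u" "e \<sqsubset> u" "w \<noteq> u" "\<not> w \<sqsubset> u"
        using upper_bound_not_above[of "{v, e}" "{}" w] N XN by auto
      have "w \<bowtie> u" using u N tr by blast
      then show ?thesis using goal[of d v w e u] N u False by blast
    qed
  qed
  have "\<forall>b\<in>B. z \<sqsubset> b" using z(2) y(2) tr by blast
  moreover have "z \<bowtie> c'" if "c' \<in> insert k C" for c'
  proof (cases "c' = k")
    case False
    then have c': "c' \<in> C" using that by blast
    then have "x \<bowtie> c'" using insert.prems by blast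
    then show ?thesis using z(1,2) y(4) c' tr by metis
  qed (use z in blast)
  ultimately show ?case using z by blast
qed

lemma move_down:
  assumes "finite A" "c \<sqsubset> x" "\<And>a. a \<in> A \<Longrightarrow> a \<sqsubset> x" "\<And>a. a \<in> A \<Longrightarrow> c \<noteq> a \<and> \<not> c \<sqsubset> a"
    and "finite C" "C \<subseteq> X" "\<And>c. c \<in> C \<Longrightarrow> x \<bowtie> c"
  shows "\<exists>y. y \<sqsubset> x \<and> (\<forall>a\<in>A. a \<sqsubset> y) \<and> y \<bowtie> c \<and> (\<forall>c\<in>C. y \<bowtie> c)"
proof -
  interpret d: hposet_gen X "\<lambda>x y. y \<sqsubset> x" by (rule dual_gen)
  show ?thesis using d.move_up[of A c x C] assms by blast
qed

text \<open>This is the extension property of the generic partial order: its last three conditions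
  are forced by the existence of \<open>x\<close>. Points of \<open>C\<close> are added one at a
  time, and a comparability with the new \<open>c\<close> is undone by \<open>move_up\<close> or
  \<open>move_down\<close>.\<close>

lemma extension:
  assumes fin: "finite A" "finite B" "finite C" and sub: "A \<subseteq> X" "B \<subseteq> X" "C \<subseteq> X"
    and "\<And>a b. a \<in> A \<Longrightarrow> b \<in> B \<Longrightarrow> a \<sqsubset> b"
    and "\<And>a c. a \<in> A \<Longrightarrow> c \<in> C \<Longrightarrow> c \<noteq> a \<and> \<not> c \<sqsubset> a"
    and "\<And>b c. b \<in> B \<Longrightarrow> c \<in> C \<Longrightarrow> c \<noteq> b \<and> \<not> b \<sqsubset> c"
  shows "\<exists>x\<in>X. (\<forall>a\<in>A. a \<sqsubset> x) \<and> (\<forall>b\<in>B. x \<sqsubset> b) \<and> (\<forall>c\<in>C. x \<bowtie> c)"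
  using fin(3) sub(3) assms(8,9)
proof (induction C rule: finite_induct)
  case empty
  then show ?case using interpolation[OF fin(1,2) sub(1,2) assms(7)] by blast
next
  case (insert c C)
  then obtain x where x: "x \<in> X" "\<forall>a\<in>A. a \<sqsubset> x" "\<forall>b\<in>B. x \<sqsubset> b" "\<forall>c\<in>C. x \<bowtie> c" by auto
  have c: "c \<in> X" "\<And>a. a \<in> A \<Longrightarrow> c \<noteq> a \<and> \<not> c \<sqsubset> a" "\<And>b. b \<in> B \<Longrightarrow> c \<noteq> b \<and> \<not> b \<sqsubset> c"
    using insert.prems by auto
  have CX: "finite C" "C \<subseteq> X" using insert by auto
  have from_above: ?case if z: "c \<sqsubset> z" "\<forall>a\<in>A. a \<sqsubset> z" "\<forall>b\<in>B. z \<sqsubset> b" "\<forall>c\<in>C. z \<bowtie> c" for z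
  proof -
    obtain y where "y \<sqsubset> z" "\<forall>a\<in>A. a \<sqsubset> y" "y \<bowtie> c" "\<forall>c\<in>C. y \<bowtie> c"
      using move_down[OF fin(1) z(1) _ c(2) CX] z(2,4) by blast
    then show ?thesis using z(3) tr fld by (intro bexI[of _ y]) blast+
  qed
  consider "x \<bowtie> c" | "x \<sqsubset> c" | "c \<sqsubset> x" | "x = c" by blast
  then show ?case
  proof cases
    case 1
    then show ?thesis using x by blast
  next
    case 2
    obtain y where "x \<sqsubset> y" "\<forall>b\<in>B. y \<sqsubset> b" "y \<bowtie> c" "\<forall>c\<in>C. y \<bowtie> c"
      using move_up[OF fin(2) 2 _ c(3) CX] x(3,4) by blast
    then show ?thesis using x(2) tr fld by (intro bexI[of _ y]) blast+
  next
    case 3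
    then show ?thesis using from_above x by blast
  next
    case 4
    \<comment> \<open>If the point found is \<open>c\<close> itself, it is first raised a little
      without becoming comparable to \<open>C\<close>; then the case above \<open>c\<close>
      applies.\<close>
    have "\<exists>z. x \<sqsubset> z \<and> (\<forall>b\<in>B. z \<sqsubset> b) \<and> (\<forall>c\<in>C. z \<bowtie> c)"
      using CX x(4)
    proof (induction C rule: finite_induct)
      case empty
      then show ?case using between_right[of B x] fin(2) x(1,3) by auto
    next
      case (insert k C)
      then obtain z where z: "x \<sqsubset> z" "\<forall>b\<in>B. z \<sqsubset> b" "\<forall>c\<in>C. z \<bowtie> c" by auto
      have "x \<bowtie> k" "k \<in> X" using insert.prems by auto
      then obtain y where y: "x \<sqsubset> y" "y \<sqsubset> z" "k \<noteq> y" "\<not> k \<sqsubset> y"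
        using upper_bound_not_above[of "{x}" "{z}" k] z(1) x(1) fld by auto
      have "y \<bowtie> k" using y \<open>x \<bowtie> k\<close> tr by blast
      moreover have "y \<bowtie> c'" if "c' \<in> C" for c'
      proof -
        have "x \<bowtie> c'" "z \<bowtie> c'" using insert.prems z(3) that by auto
        then show ?thesis using y(1,2) tr by metis
      qed
      ultimately show ?case using y(1,2) z(2) tr by (intro exI[of _ y]) blast
    qed
    then obtain z where z: "c \<sqsubset> z" "\<forall>b\<in>B. z \<sqsubset> b" "\<forall>c\<in>C. z \<bowtie> c" using 4 by blast
    have "\<forall>a\<in>A. a \<sqsubset> z" using x(2) z(1) 4 tr by blast
    then show ?thesis using from_above[OF z(1) _ z(2,3)] by blast
  qed
qed

end

section \<open>Antichains of copies\<close>

text \<open>Let \<open>M\<close> come from Zorn's lemma. A \<open>p\<close> incompatible with all of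
  \<open>M\<close> is compatible with itself, hence lies outside \<open>M\<close>, and adding it
  would give a larger antichain.\<close>

lemma antichain_extends_to_maximal:
  assumes "antichain_in P le C0" "\<And>p. p \<in> P \<Longrightarrow> le p p"
  shows "\<exists>C. C0 \<subseteq> C \<and> maximal_antichain_in P le C"
proof -
  define \<A> where "\<A> = {C. antichain_in P le C \<and> C0 \<subseteq> C}"
  have "\<A> \<noteq> {}" using assms(1) unfolding \<A>_def by blast
  moreover have "\<Union>\<C> \<in> \<A>" if "\<C> \<noteq> {}" "subset.chain \<A> \<C>" for \<C>
  proof -
    have sub: "\<C> \<subseteq> \<A>" and lin: "\<And>C D. C \<in> \<C> \<Longrightarrow> D \<in> \<C> \<Longrightarrow> C \<subseteq> D \<or> D \<subseteq> C"
      using that(2) unfolding subset_chain_def by auto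
    have anti: "antichain_in P le C" "C0 \<subseteq> C" if "C \<in> \<C>" for C
      using sub that unfolding \<A>_def by auto
    have "\<not> compatible_in P le a b" if ab: "a \<in> \<Union>\<C>" "b \<in> \<Union>\<C>" "a \<noteq> b" for a b
    proof -
      obtain C D where CD: "C \<in> \<C>" "a \<in> C" "D \<in> \<C>" "b \<in> D" using ab by blast
      show ?thesis
      proof (cases "C \<subseteq> D")
        case True
        then show ?thesis using anti(1)[of D] CD ab(3) unfolding antichain_in_def by blast
      next
        case False
        then have "D \<subseteq> C" using lin CD by blast
        then show ?thesis using anti(1)[of C] CD ab(3) unfolding antichain_in_def by blast
      qed
    qed
    moreover have "\<Union>\<C> \<subseteq> P" using anti(1) unfolding antichain_in_def by blast
    moreover have "C0 \<subseteq> \<Union>\<C>" using that(1) anti(2) by blast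
    ultimately show ?thesis unfolding \<A>_def antichain_in_def by blast
  qed
  ultimately obtain M where M: "M \<in> \<A>" "\<And>C. C \<in> \<A> \<Longrightarrow> M \<subseteq> C \<Longrightarrow> C = M"
    using subset_Zorn_nonempty[of \<A>] by blast
  have "\<exists>a\<in>M. compatible_in P le p a" if "p \<in> P" for p
  proof (rule ccontr)
    assume no: "\<not> (\<exists>a\<in>M. compatible_in P le p a)"
    have "compatible_in P le p p" using assms(2) that unfolding compatible_in_def by blast
    then have "p \<notin> M" using no by blast
    have "\<not> compatible_in P le a p" if "a \<in> M" for a
      using no that unfolding compatible_in_def by blast
    then have "antichain_in P le (insert p M)"
      using M(1) no that unfolding \<A>_def antichain_in_def by blast
    then have "insert p M \<in> \<A>" using M(1) unfolding \<A>_def by blast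
    then show False using M(2)[of "insert p M"] \<open>p \<notin> M\<close> by blast
  qed
  then show ?thesis using M(1) unfolding \<A>_def maximal_antichain_in_def by blast
qed

text \<open>Each \<open>q n\<close> has to avoid only finitely many values of \<open>e\<close>. This
  serves twice: for the nodes of the binary tree and for the blocks of the diagonal copy.\<close>

lemma ex_injective_choice:
  fixes J :: "nat \<Rightarrow> 'a set"
  assumes "\<And>n. infinite (e ` J n)"
  shows "\<exists>q. (\<forall>n. q n \<in> J n) \<and> inj (\<lambda>n. e (q n))"
proof -
  define P where "P f n x \<longleftrightarrow> x \<in> J n \<and> e x \<notin> e ` f ` {..<n}" for f n x
  have "\<exists>q. \<forall>n. P q n (q n)"
  proof (rule dependent_wellorder_choice)
    fix x :: 'a and f g :: "nat \<Rightarrow> 'a" and n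
    assume "\<And>m. m < n \<Longrightarrow> f m = g m"
    then have "f ` {..<n} = g ` {..<n}" by (intro image_cong) auto
    then show "P f n x = P g n x" unfolding P_def by simp
  next
    fix n and f :: "nat \<Rightarrow> 'a"
    have "finite (e ` f ` {..<n})" by simp
    then have "\<not> e ` J n \<subseteq> e ` f ` {..<n}" using assms finite_subset by blast
    then show "\<exists>x. P f n x" unfolding P_def by blast
  qed
  then obtain q where q: "\<And>n. P q n (q n)" by blast
  have "e (q m) \<noteq> e (q n)" if "m < n" for m n
  proof -
    have "e (q m) \<in> e ` q ` {..<n}" using that by blast
    then show ?thesis using q[of n] unfolding P_def by metis
  qed
  then have "inj (\<lambda>n. e (q n))" by (intro injI) (metis linorder_neqE_nat)
  then show ?thesis using q unfolding P_def by blast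
qed

section \<open>The tree construction and the slicing construction\<close>

context hposet
begin

lemma copies_infinite: "B \<in> copies X r \<Longrightarrow> infinite B"
  using iX bij_betw_finite unfolding copies_def isomorphic_def rel_iso_def by blast

definition realizations where
  "realizations F x = {y \<in> X. \<forall>z\<in>F. y \<noteq> z \<and> (y \<sqsubset> z \<longleftrightarrow> x \<sqsubset> z) \<and> (z \<sqsubset> y \<longleftrightarrow> z \<sqsubset> x)}"

text \<open>The map \<open>e\<close> is the identity except when incomparability is transitive: incomparability
  classes may be finite, so there a branch has to take them as a whole.\<close>

lemma continuum_antichain:
  assumes real: "\<And>F x. \<lbrakk>finite F; F \<subseteq> X; x \<in> X; e x \<notin> e ` F\<rbrakk> \<Longrightarrow> infinite (e ` realizations F x)"
    and inf: "\<And>B. B \<in> copies X r \<Longrightarrow> infinite (e ` B)"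
  shows "\<exists>C. maximal_antichain_in (copies X r) (\<subseteq>) C \<and> C \<approx> (UNIV :: nat set set)"
proof -
  \<comment> \<open>A countable list of the one-types over finite sets; those whose value of
    \<open>e\<close> already occurs on \<open>F\<close> are left out.\<close>
  define T where "T = {(F, x). finite F \<and> F \<subseteq> X \<and> x \<in> X \<and> e x \<notin> e ` F}"
  have "T \<subseteq> {F. finite F \<and> F \<subseteq> X} \<times> X" unfolding T_def by blast
  then have cT: "countable T"
    using countable_Collect_finite_subset[OF cX] cX by (meson countable_SIGMA countable_subset)
  obtain x0 where "x0 \<in> X" using iX by fastforce
  then have "({}, x0) \<in> T" unfolding T_def by simp
  then have T0: "T \<noteq> {}" by blast
  define J where "J n = realizations (fst (from_nat_into T n)) (snd (from_nat_into T n))" for n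
  have "infinite (e ` J n)" for n
    using from_nat_into[OF T0, of n] real unfolding J_def T_def by auto
  \<comment> \<open>A word of length \<open>k\<close> receives a realization of type number
    \<open>k\<close>, so every branch realizes every listed type.\<close>
  then obtain q where q: "\<And>n. q n \<in> J (length (from_nat n :: bool list))" "inj (\<lambda>n. e (q n))"
    using ex_injective_choice[of e "\<lambda>n. J (length (from_nat n :: bool list))"] by blast
  define p where "p s = q (to_nat s)" for s :: "bool list"
  have pJ: "p s \<in> J (length s)" for s using q(1)[of "to_nat s"] by (simp add: p_def)
  have pinj: "s = t" if "e (p s) = e (p t)" for s t
    using q(2) that by (auto simp: p_def dest: injD)
  define b where "b z n = map (\<lambda>i. i \<in> z) [0..<n]" for z :: "nat set" and n
  \<comment> \<open>The branch is closed under equality of \<open>e\<close>. This settles the types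
    left out of \<open>T\<close>: there \<open>x\<close> itself belongs to the branch.\<close>
  define A where "A z = {x \<in> X. \<exists>n. e x = e (p (b z n))}" for z
  have copy: "A z \<in> copies X r" for z
  proof (rule copy_criterion)
    show "A z \<subseteq> X" unfolding A_def by blast
    fix F x assume F: "finite F" "F \<subseteq> A z" "x \<in> X" "x \<notin> F"
    show "\<exists>y\<in>A z. \<forall>w\<in>F. y \<noteq> w \<and> (y \<sqsubset> w \<longleftrightarrow> x \<sqsubset> w) \<and> (w \<sqsubset> y \<longleftrightarrow> w \<sqsubset> x)"
    proof (cases "e x \<in> e ` F")
      case True
      then have "x \<in> A z" using F unfolding A_def by auto
      then show ?thesis using F(4) by blast
    next
      case False
      then have "(F, x) \<in> T" using F unfolding T_def A_def by auto
      then obtain n where "from_nat_into T n = (F, x)" using from_nat_into_surj[OF cT] by blast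
      then have "p (b z n) \<in> realizations F x"
        using pJ[of "b z n"] unfolding J_def b_def by simp
      then show ?thesis unfolding realizations_def A_def by blast
    qed
  qed
  have small: "finite (e ` (A z \<inter> A w))" if "z \<noteq> w" for z w
  proof -
    obtain i where i: "(i \<in> z) \<noteq> (i \<in> w)" using \<open>z \<noteq> w\<close> by blast
    \<comment> \<open>Prefixes longer than \<open>i\<close> differ at place \<open>i\<close>, so by
      injectivity the two branches share only nodes of length at most \<open>i\<close>.\<close>
    have "e ` (A z \<inter> A w) \<subseteq> (\<lambda>n. e (p (b z n))) ` {..i}"
    proof
      fix v assume "v \<in> e ` (A z \<inter> A w)"
      then obtain m n where mn: "v = e (p (b z m))" "v = e (p (b w n))" unfolding A_def by auto
      then have eq: "b z m = b w n" using pinj by simp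
      then have "length (b z m) = length (b w n)" by simp
      then have "m = n" unfolding b_def by simp
      have "m \<le> i"
      proof (rule ccontr)
        assume "\<not> m \<le> i"
        then have "b z m ! i = (i \<in> z)" "b w n ! i = (i \<in> w)" using \<open>m = n\<close> unfolding b_def by auto
        then show False using eq i by simp
      qed
      then show "v \<in> (\<lambda>n. e (p (b z n))) ` {..i}" using mn by blast
    qed
    then show ?thesis using finite_subset by blast
  qed
  have compat: "z = w" if "compatible_in (copies X r) (\<subseteq>) (A z) (A w)" for z w
  proof (rule ccontr)
    assume "z \<noteq> w"
    obtain B where "B \<in> copies X r" "B \<subseteq> A z \<inter> A w"
      using \<open>compatible_in (copies X r) (\<subseteq>) (A z) (A w)\<close> unfolding compatible_in_def by blast
    then show False using inf[of B] small[OF \<open>z \<noteq> w\<close>] by (meson finite_subset image_mono)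
  qed
  have "inj A"
  proof (rule injI, rule ccontr)
    fix z w assume "A z = A w" "z \<noteq> w"
    then show False using small[of z w] inf[OF copy[of z]] by simp
  qed
  have "antichain_in (copies X r) (\<subseteq>) (range A)"
    unfolding antichain_in_def using copy by (auto dest!: compat)
  then obtain C where C: "range A \<subseteq> C" "maximal_antichain_in (copies X r) (\<subseteq>) C"
    using antichain_extends_to_maximal[of "copies X r" "(\<subseteq>)" "range A"] by auto
  have "(UNIV :: nat set set) \<lesssim> C" using \<open>inj A\<close> C(1) unfolding lepoll_def by blast
  moreover have "C \<subseteq> Pow X"
    using C(2) unfolding maximal_antichain_in_def antichain_in_def copies_def by blast
  then have "inj_on (image (to_nat_on X)) C"
    using inj_on_image_Pow[OF inj_on_to_nat_on[OF cX]] inj_on_subset by blast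
  then have "C \<lesssim> (UNIV :: nat set set)" unfolding lepoll_def by blast
  ultimately show ?thesis using C(2) lepoll_antisym by blast
qed

lemma cofinal_chain:
  assumes "K \<subseteq> X" "K \<noteq> {}" "\<And>x y. x \<in> K \<Longrightarrow> y \<in> K \<Longrightarrow> \<exists>u\<in>K. x \<sqsubset> u \<and> y \<sqsubset> u"
  shows "\<exists>d :: nat \<Rightarrow> 'a. (\<forall>n. d n \<in> K) \<and> (\<forall>m n. m < n \<longrightarrow> d m \<sqsubset> d n) \<and> (\<forall>x\<in>K. \<exists>n. x \<sqsubset> d n)"
proof -
  have cK: "countable K" using assms(1) cX countable_subset by blast
  have "\<exists>d. \<forall>n. d n \<in> K \<and> (d n \<sqsubset> d (Suc n) \<and> from_nat_into K n \<sqsubset> d (Suc n))"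
  proof (rule dependent_nat_choice)
    show "\<exists>x. x \<in> K" using assms(2) by blast
    show "\<exists>y. y \<in> K \<and> (x \<sqsubset> y \<and> from_nat_into K n \<sqsubset> y)" if "x \<in> K" for x n
      using assms(3)[OF that from_nat_into[OF assms(2), of n]] by blast
  qed
  then obtain d where d: "\<forall>n. d n \<in> K \<and> (d n \<sqsubset> d (Suc n) \<and> from_nat_into K n \<sqsubset> d (Suc n))" ..
  have "d m \<sqsubset> d n" if "m < n" for m n
    using that
  proof (induction n)
    case (Suc n)
    then show ?case using d[rule_format, of n] tr by (metis less_Suc_eq)
  qed simp
  moreover have "\<exists>n. x \<sqsubset> d n" if "x \<in> K" for x
    using d from_nat_into_surj[OF cK that] by metis
  ultimately show ?thesis using d by (intro exI[of _ d]) blast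
qed

text \<open>Every copy meets \<open>K\<close>, so copies that are disjoint inside \<open>K\<close>
  are incompatible, and only \<open>K\<close> has to be sliced. In \<open>step\<close> the copy is
  sandwiched because the full slice may have minimal points: it must contain just those slice points
  that have a predecessor in \<open>K\<close> not below \<open>d\<close>.\<close>

lemma countable_antichain:
  assumes "K \<subseteq> X" "K \<noteq> {}" "\<And>x y. x \<in> K \<Longrightarrow> y \<in> K \<Longrightarrow> \<exists>u\<in>K. x \<sqsubset> u \<and> y \<sqsubset> u"
    and meets: "\<And>B. B \<in> copies X r \<Longrightarrow> B \<inter> K \<noteq> {}"
    and first: "\<And>e. e \<in> K \<Longrightarrow> {x \<in> X. x \<in> K \<longrightarrow> x \<sqsubset> e} \<in> copies X r"
    and below: "\<And>B b. B \<in> copies X r \<Longrightarrow> b \<in> B \<Longrightarrow> b \<in> K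
      \<Longrightarrow> \<exists>B'\<in>copies X r. B' \<subseteq> {x \<in> B. x \<in> K \<longrightarrow> x \<sqsubset> b}"
    and step: "\<And>d e. d \<in> K \<Longrightarrow> e \<in> K \<Longrightarrow> d \<sqsubset> e \<Longrightarrow> \<exists>M\<in>copies X r.
      {x \<in> X. x \<in> K \<longrightarrow> x \<sqsubset> e \<and> (\<exists>y\<in>K. y \<sqsubset> x \<and> \<not> y \<sqsubset> d)} \<subseteq> M \<and>
      M \<subseteq> {x. x \<in> K \<longrightarrow> x \<sqsubset> e \<and> \<not> x \<sqsubset> d}"
  shows "\<exists>C. maximal_antichain_in (copies X r) (\<subseteq>) C \<and> countable C \<and> infinite C"
proof -
  obtain d :: "nat \<Rightarrow> 'a" where
    "(\<forall>n. d n \<in> K) \<and> (\<forall>m n. m < n \<longrightarrow> d m \<sqsubset> d n) \<and> (\<forall>x\<in>K. \<exists>n. x \<sqsubset> d n)"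
    using cofinal_chain[OF assms(1-3)] ..
  then have d: "d n \<in> K" "m < n \<Longrightarrow> d m \<sqsubset> d n" "x \<in> K \<Longrightarrow> \<exists>n. x \<sqsubset> d n" for m n x
    by auto
  have "\<forall>n. \<exists>M. M \<in> copies X r \<and>
      {x \<in> X. x \<in> K \<longrightarrow> x \<sqsubset> d (Suc n) \<and> (\<exists>y\<in>K. y \<sqsubset> x \<and> \<not> y \<sqsubset> d n)} \<subseteq> M \<and>
      M \<subseteq> {x. x \<in> K \<longrightarrow> x \<sqsubset> d (Suc n) \<and> \<not> x \<sqsubset> d n}"
    using step[OF d(1) d(1) d(2)[OF lessI]] by (simp add: Bex_def)
  from choice[OF this] obtain N where N0: "\<forall>n. N n \<in> copies X r \<and>
      {x \<in> X. x \<in> K \<longrightarrow> x \<sqsubset> d (Suc n) \<and> (\<exists>y\<in>K. y \<sqsubset> x \<and> \<not> y \<sqsubset> d n)} \<subseteq> N n \<and>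
      N n \<subseteq> {x. x \<in> K \<longrightarrow> x \<sqsubset> d (Suc n) \<and> \<not> x \<sqsubset> d n}" ..
  then have N: "N n \<in> copies X r"
      "{x \<in> X. x \<in> K \<longrightarrow> x \<sqsubset> d (Suc n) \<and> (\<exists>y\<in>K. y \<sqsubset> x \<and> \<not> y \<sqsubset> d n)} \<subseteq> N n"
      "N n \<subseteq> {x. x \<in> K \<longrightarrow> x \<sqsubset> d (Suc n) \<and> \<not> x \<sqsubset> d n}" for n
    by blast+
  \<comment> \<open>A shift by one: \<open>M 0\<close> takes what lies below \<open>d 0\<close>, and
    the slice between \<open>d k\<close> and \<open>d (Suc k)\<close> gets number
    \<open>Suc k\<close>.\<close>
  define M where "M n = (case n of 0 \<Rightarrow> {x \<in> X. x \<in> K \<longrightarrow> x \<sqsubset> d 0} | Suc k \<Rightarrow> N k)" for n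
  have M: "M n \<in> copies X r" for n
    using first d(1) N(1) by (cases n) (auto simp: M_def)
  have Mup: "x \<sqsubset> d n" if "x \<in> M n" "x \<in> K" for x n
    using that N(3) by (cases n) (auto simp: M_def)
  have disj: "M m \<inter> M n \<inter> K = {}" if mn: "m < n" for m n
  proof (rule ccontr)
    assume "M m \<inter> M n \<inter> K \<noteq> {}"
    then obtain x where x: "x \<in> M m" "x \<in> M n" "x \<in> K" by blast
    obtain k where k: "n = Suc k" using mn by (cases n) auto
    then have "\<not> x \<sqsubset> d k" using x N(3) by (auto simp: M_def)
    moreover have "x \<sqsubset> d k"
    proof (cases "m = k")
      case True
      then show ?thesis using Mup[OF x(1,3)] by simp
    next
      case False
      then have "d m \<sqsubset> d k" using d(2) mn k by simp
      then show ?thesis using Mup[OF x(1,3)] tr by blast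
    qed
    ultimately show False by blast
  qed
  have disj': "M m \<inter> M n \<inter> K = {}" if "m \<noteq> n" for m n
    using disj[of m n] disj[of n m] that by (metis Int_commute linorder_neqE_nat)
  have compat: "m = n" if "compatible_in (copies X r) (\<subseteq>) (M m) (M n)" for m n
  proof (rule ccontr)
    assume "m \<noteq> n"
    obtain B where "B \<in> copies X r" "B \<subseteq> M m \<inter> M n"
      using \<open>compatible_in (copies X r) (\<subseteq>) (M m) (M n)\<close> unfolding compatible_in_def by blast
    then show False using disj'[OF \<open>m \<noteq> n\<close>] meets by blast
  qed
  have "inj M"
  proof (rule injI, rule ccontr)
    fix m n assume "M m = M n" "m \<noteq> n"
    then show False using disj'[of m n] meets[OF M[of m]] by simp
  qed
  have "\<exists>A\<in>range M. compatible_in (copies X r) (\<subseteq>) B A" if B: "B \<in> copies X r" for B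
  proof -
    obtain b0 where "b0 \<in> B" "b0 \<in> K" using meets[OF B] by blast
    then have ex: "\<exists>n. \<exists>b\<in>B \<inter> K. b \<sqsubset> d n" using d(3) by blast
    \<comment> \<open>By minimality no point of \<open>B\<close> in \<open>K\<close> lies below an
      earlier \<open>d k\<close>, so the copy cut off under \<open>b\<close> fits into slice
      \<open>n\<close>.\<close>
    define n where "n = (LEAST n. \<exists>b\<in>B \<inter> K. b \<sqsubset> d n)"
    obtain b where b: "b \<in> B" "b \<in> K" "b \<sqsubset> d n"
      using LeastI_ex[OF ex] unfolding n_def by blast
    have least: "\<not> y \<sqsubset> d k" if "y \<in> B" "y \<in> K" "k < n" for y k
      using not_less_Least[of k] that unfolding n_def by blast
    obtain B' where B': "B' \<in> copies X r" "B' \<subseteq> {x \<in> B. x \<in> K \<longrightarrow> x \<sqsubset> b}"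
      using below[OF B b(1,2)] by blast
    have BX: "B' \<subseteq> X" using B'(1) unfolding copies_def by blast
    have "B' \<subseteq> M n"
    proof
      fix x assume x: "x \<in> B'"
      have up: "x \<sqsubset> d n" if "x \<in> K" using that x B'(2) b(3) tr by blast
      show "x \<in> M n"
      proof (cases n)
        case 0
        then show ?thesis using up x BX by (auto simp: M_def)
      next
        case (Suc k)
        \<comment> \<open>A copy inside \<open>B\<close> below \<open>x\<close> supplies the
          predecessor that the lower half of the sandwich asks for.\<close>
        have "\<exists>y\<in>K. y \<sqsubset> x \<and> \<not> y \<sqsubset> d k" if xK: "x \<in> K"
        proof -
          obtain B'' where B'': "B'' \<in> copies X r" "B'' \<subseteq> {y \<in> B. y \<in> K \<longrightarrow> y \<sqsubset> x}"
            using below[OF B _ xK] x B'(2) by blast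
          obtain y where "y \<in> B''" "y \<in> K" using meets[OF B''(1)] by blast
          then show ?thesis using B''(2) least[of y k] Suc by blast
        qed
        then have "x \<in> N k" using N(2)[of k] up Suc x BX by blast
        then show ?thesis using Suc by (simp add: M_def)
      qed
    qed
    then show ?thesis using B' unfolding compatible_in_def by blast
  qed
  then have "maximal_antichain_in (copies X r) (\<subseteq>) (range M)"
    unfolding maximal_antichain_in_def antichain_in_def using M by (auto dest!: compat)
  moreover have "infinite (range M)" using \<open>inj M\<close> by (rule range_inj_infinite)
  ultimately show ?thesis by blast
qed

end

text \<open>Here \<open>K\<close> is all of \<open>X\<close>. The copy inside \<open>B\<close> and
  below \<open>b\<close> is the image, under an isomorphism onto \<open>B\<close>, of the down-set
  of the point that goes to \<open>b\<close>.\<close>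

lemma (in hposet_dir) countable_antichain_directed:
  assumes "\<And>d e. d \<sqsubset> e \<Longrightarrow> \<exists>M\<in>copies X r.
      {x. x \<sqsubset> e \<and> (\<exists>y. y \<sqsubset> x \<and> \<not> y \<sqsubset> d)} \<subseteq> M \<and> M \<subseteq> {x. x \<sqsubset> e \<and> \<not> x \<sqsubset> d}"
  shows "\<exists>C. maximal_antichain_in (copies X r) (\<subseteq>) C \<and> countable C \<and> infinite C"
proof (rule countable_antichain[of X])
  show "X \<noteq> {}" using iX by auto
  show "\<exists>u\<in>X. x \<sqsubset> u \<and> y \<sqsubset> u" if "x \<in> X" "y \<in> X" for x y using up that fld by blast
  have sub: "B \<subseteq> X" if "B \<in> copies X r" for B using that unfolding copies_def by blast
  show "B \<inter> X \<noteq> {}" if "B \<in> copies X r" for B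
    using copies_infinite[OF that] sub[OF that] by (metis finite.emptyI inf.absorb1)
  have Xd: "{x \<in> X. x \<in> X \<longrightarrow> x \<sqsubset> e} = {x. x \<sqsubset> e}" for e using fld by blast
  show "{x \<in> X. x \<in> X \<longrightarrow> x \<sqsubset> e} \<in> copies X r" if "e \<in> X" for e
    unfolding Xd by (rule down_set_copy[OF that])
  show "\<exists>B'\<in>copies X r. B' \<subseteq> {x \<in> B. x \<in> X \<longrightarrow> x \<sqsubset> b}" if B: "B \<in> copies X r" "b \<in> B" for B b
  proof -
    obtain f where f: "rel_iso X r B r f" using copies_iso[OF B(1)] .
    then obtain a where a: "a \<in> X" "f a = b"
      using B(2) unfolding rel_iso_def bij_betw_def by blast
    note c = copies_in_copy[OF f B(1) down_set_copy[OF a(1)]]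
    have "f x \<sqsubset> b" if "x \<sqsubset> a" for x
      using f that fld a unfolding rel_iso_def by blast
    then show ?thesis using c by (intro bexI[of _ "f ` {x. x \<sqsubset> a}"]) auto
  qed
  show "\<exists>M\<in>copies X r.
      {x \<in> X. x \<in> X \<longrightarrow> x \<sqsubset> e \<and> (\<exists>y\<in>X. y \<sqsubset> x \<and> \<not> y \<sqsubset> d)} \<subseteq> M \<and>
      M \<subseteq> {x. x \<in> X \<longrightarrow> x \<sqsubset> e \<and> \<not> x \<sqsubset> d}" if de: "d \<sqsubset> e" for d e
  proof -
    obtain M where M: "M \<in> copies X r" "{x. x \<sqsubset> e \<and> (\<exists>y. y \<sqsubset> x \<and> \<not> y \<sqsubset> d)} \<subseteq> M"
      "M \<subseteq> {x. x \<sqsubset> e \<and> \<not> x \<sqsubset> d}" using assms[OF de] by blast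
    then show ?thesis by (intro bexI[of _ M]) auto
  qed
qed simp

section \<open>Both antichains for orders with the extension property\<close>

context hposet_gen
begin

text \<open>From finitely many realizations the extension property would produce one more,
  incomparable to all of them.\<close>

lemma infinite_realizations:
  assumes "finite F" "F \<subseteq> X" "x \<in> X" "x \<notin> F"
  shows "infinite (realizations F x)"
proof
  assume fin: "finite (realizations F x)"
  define R where "R = realizations F x"
  have "R \<subseteq> X" unfolding R_def realizations_def by blast
  have "\<exists>y\<in>X. (\<forall>a\<in>{f \<in> F. f \<sqsubset> x}. a \<sqsubset> y) \<and> (\<forall>b\<in>{f \<in> F. x \<sqsubset> f}. y \<sqsubset> b)
    \<and> (\<forall>c\<in>{f \<in> F. f \<bowtie> x} \<union> R. y \<bowtie> c)"
  proof (rule extension)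
    show "a \<sqsubset> b" if "a \<in> {f \<in> F. f \<sqsubset> x}" "b \<in> {f \<in> F. x \<sqsubset> f}" for a b
      using that tr by blast
    show "c \<noteq> a \<and> \<not> c \<sqsubset> a" if "a \<in> {f \<in> F. f \<sqsubset> x}" "c \<in> {f \<in> F. f \<bowtie> x} \<union> R" for a c
      using that tr asym irr unfolding R_def realizations_def by blast
    show "c \<noteq> b \<and> \<not> b \<sqsubset> c" if "b \<in> {f \<in> F. x \<sqsubset> f}" "c \<in> {f \<in> F. f \<bowtie> x} \<union> R" for b c
      using that tr asym irr unfolding R_def realizations_def by blast
  qed (use assms fin \<open>R \<subseteq> X\<close> in \<open>auto simp: R_def\<close>)
  then obtain y where y: "y \<in> X" "\<forall>a\<in>{f \<in> F. f \<sqsubset> x}. a \<sqsubset> y" "\<forall>b\<in>{f \<in> F. x \<sqsubset> f}. y \<sqsubset> b"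
    "\<forall>c\<in>{f \<in> F. f \<bowtie> x} \<union> R. y \<bowtie> c" by blast
  have "y \<noteq> z \<and> (y \<sqsubset> z \<longleftrightarrow> x \<sqsubset> z) \<and> (z \<sqsubset> y \<longleftrightarrow> z \<sqsubset> x)" if z: "z \<in> F" for z
  proof -
    consider "z \<sqsubset> x" | "x \<sqsubset> z" | "z \<bowtie> x" using z assms(4) by blast
    then show ?thesis
      by cases (use y z asym irr in blast)+
  qed
  then have "y \<in> R" using y(1) unfolding R_def realizations_def by blast
  then show False using y(4) by blast
qed

lemma continuum_antichain_gen:
  "\<exists>C. maximal_antichain_in (copies X r) (\<subseteq>) C \<and> C \<approx> (UNIV :: nat set set)"
proof (rule continuum_antichain[of id])
  show "infinite (id ` realizations F x)"
    if "finite F" "F \<subseteq> X" "x \<in> X" "id x \<notin> id ` F" for F x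
    using infinite_realizations[of F x] that by simp
qed (simp add: copies_infinite)

lemma countable_antichain_gen:
  "\<exists>C. maximal_antichain_in (copies X r) (\<subseteq>) C \<and> countable C \<and> infinite C"
proof (rule countable_antichain_directed)
  fix d e assume de: "d \<sqsubset> e"
  define M where "M = {x. x \<sqsubset> e \<and> x \<noteq> d \<and> \<not> x \<sqsubset> d}"
  have deX: "d \<in> X" "e \<in> X" using de fld by auto
  have "M \<in> copies X r"
  proof (rule copy_criterion)
    show "M \<subseteq> X" using fld unfolding M_def by blast
    fix F x assume F: "finite F" "F \<subseteq> M" "x \<in> X" "x \<notin> F"
    have FX: "F \<subseteq> X" using F(2) fld unfolding M_def by blast
    define A where "A = {f \<in> F. f \<sqsubset> x}"
    define B where "B = insert e {f \<in> F. x \<sqsubset> f}"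
    \<comment> \<open>The new point must not lie at or below \<open>d\<close>. Above some
      \<open>a\<close> in \<open>A\<close> this is automatic, as \<open>a\<close> is not below
      \<open>d\<close>, while asking for incomparability could clash with an \<open>a\<close> above
      \<open>d\<close>. So \<open>d\<close> is added only when \<open>A\<close> is empty.\<close>
    define C where "C = {f \<in> F. f \<bowtie> x} \<union> (if A = {} then {d} else {})"
    have FM: "f \<sqsubset> e" "f \<noteq> d" "\<not> f \<sqsubset> d" if "f \<in> F" for f
      using that F(2) unfolding M_def by auto
    have "\<exists>y\<in>X. (\<forall>a\<in>A. a \<sqsubset> y) \<and> (\<forall>b\<in>B. y \<sqsubset> b) \<and> (\<forall>c\<in>C. y \<bowtie> c)"
    proof (rule extension)
      show "finite A" "finite B" "finite C" "A \<subseteq> X" "B \<subseteq> X" "C \<subseteq> X"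
        using F(1) FX deX unfolding A_def B_def C_def by auto
      show "a \<sqsubset> b" if "a \<in> A" "b \<in> B" for a b
        using that FM(1) tr unfolding A_def B_def by blast
      show "c \<noteq> a \<and> \<not> c \<sqsubset> a" if "a \<in> A" "c \<in> C" for a c
        using that tr unfolding A_def C_def by (auto split: if_splits)
      show "c \<noteq> b \<and> \<not> b \<sqsubset> c" if "b \<in> B" "c \<in> C" for b c
      proof -
        have "b = e \<or> b \<in> F \<and> x \<sqsubset> b" using that(1) unfolding B_def by blast
        moreover have "c = d \<or> c \<in> F \<and> c \<bowtie> x" using that(2) unfolding C_def by (auto split: if_splits)
        ultimately show ?thesis using FM de tr asym irr by metis
      qed
    qed
    then obtain y where y: "y \<in> X" "\<forall>a\<in>A. a \<sqsubset> y" "\<forall>b\<in>B. y \<sqsubset> b" "\<forall>c\<in>C. y \<bowtie> c" by blast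
    have "y \<noteq> d \<and> \<not> y \<sqsubset> d"
    proof (cases "A = {}")
      case True
      then show ?thesis using y(4) unfolding C_def by auto
    next
      case False
      then obtain a where "a \<in> F" "a \<sqsubset> y" using y(2) unfolding A_def by blast
      then show ?thesis using FM[of a] tr by blast
    qed
    then have "y \<in> M" using y(3) unfolding M_def B_def by blast
    moreover have "y \<noteq> z \<and> (y \<sqsubset> z \<longleftrightarrow> x \<sqsubset> z) \<and> (z \<sqsubset> y \<longleftrightarrow> z \<sqsubset> x)" if z: "z \<in> F" for z
    proof -
      consider "z \<in> A" | "z \<in> B" "x \<sqsubset> z" | "z \<in> C" "z \<bowtie> x"
        using z F(4) unfolding A_def B_def C_def by blast
      then show ?thesis
        by cases (use y asym irr A_def in blast)+
    qed
    ultimately show "\<exists>y\<in>M. \<forall>z\<in>F. y \<noteq> z \<and> (y \<sqsubset> z \<longleftrightarrow> x \<sqsubset> z) \<and> (z \<sqsubset> y \<longleftrightarrow> z \<sqsubset> x)"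
      by blast
  qed
  then show "\<exists>M\<in>copies X r.
      {x. x \<sqsubset> e \<and> (\<exists>y. y \<sqsubset> x \<and> \<not> y \<sqsubset> d)} \<subseteq> M \<and> M \<subseteq> {x. x \<sqsubset> e \<and> \<not> x \<sqsubset> d}"
    using tr unfolding M_def by (intro bexI[of _ M]) (auto simp: M_def)
qed

end

section \<open>Disjoint unions of dense chains\<close>

text \<open>A disjoint union of dense chains without endpoints. The free map \<open>c\<close> names
  the components: it allows components of different orders to be matched, and subsets inherit the
  names.\<close>

definition dlo_forest :: "'a set \<Rightarrow> ('a \<Rightarrow> 'a \<Rightarrow> bool) \<Rightarrow> ('a \<Rightarrow> 'b) \<Rightarrow> bool" where
  "dlo_forest A r c \<longleftrightarrow> strict_poset A r \<and>
     (\<forall>x\<in>A. \<forall>y\<in>A. c x = c y \<longleftrightarrow> x = y \<or> r x y \<or> r y x) \<and>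
     (\<forall>x\<in>A. (\<exists>y\<in>A. r y x) \<and> (\<exists>y\<in>A. r x y)) \<and>
     (\<forall>x\<in>A. \<forall>y\<in>A. r x y \<longrightarrow> (\<exists>z\<in>A. r x z \<and> r z y))"

lemma dlo_forestD:
  assumes "dlo_forest A r c"
  shows "x \<in> A \<Longrightarrow> \<not> r x x"
    and "x \<in> A \<Longrightarrow> y \<in> A \<Longrightarrow> z \<in> A \<Longrightarrow> r x y \<Longrightarrow> r y z \<Longrightarrow> r x z"
    and "x \<in> A \<Longrightarrow> y \<in> A \<Longrightarrow> c x = c y \<longleftrightarrow> x = y \<or> r x y \<or> r y x"
    and "x \<in> A \<Longrightarrow> \<exists>y\<in>A. r y x"
    and "x \<in> A \<Longrightarrow> \<exists>y\<in>A. r x y"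
    and "x \<in> A \<Longrightarrow> y \<in> A \<Longrightarrow> r x y \<Longrightarrow> \<exists>z\<in>A. r x z \<and> r z y"
  using assms unfolding dlo_forest_def strict_poset_def
  by (auto dest: irreflp_onD transp_onD)

lemma dlo_forestI:
  assumes "\<And>x. x \<in> A \<Longrightarrow> \<not> r x x"
    and "\<And>x y z. x \<in> A \<Longrightarrow> y \<in> A \<Longrightarrow> z \<in> A \<Longrightarrow> r x y \<Longrightarrow> r y z \<Longrightarrow> r x z"
    and "\<And>x y. x \<in> A \<Longrightarrow> y \<in> A \<Longrightarrow> c x = c y \<longleftrightarrow> x = y \<or> r x y \<or> r y x"
    and "\<And>x. x \<in> A \<Longrightarrow> \<exists>y\<in>A. r y x"
    and "\<And>x. x \<in> A \<Longrightarrow> \<exists>y\<in>A. r x y"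
    and "\<And>x y. x \<in> A \<Longrightarrow> y \<in> A \<Longrightarrow> r x y \<Longrightarrow> \<exists>z\<in>A. r x z \<and> r z y"
  shows "dlo_forest A r c"
  unfolding dlo_forest_def strict_poset_def
proof (intro conjI ballI impI)
  show "irreflp_on A r" using assms(1) by (rule irreflp_onI)
  show "transp_on A r" using assms(2) by (rule transp_onI)
  show "c x = c y \<longleftrightarrow> x = y \<or> r x y \<or> r y x" if "x \<in> A" "y \<in> A" for x y
    using assms(3)[OF that] .
  show "\<exists>y\<in>A. r y x" "\<exists>y\<in>A. r x y" if "x \<in> A" for x
    using assms(4,5)[OF that] .
  show "\<exists>z\<in>A. r x z \<and> r z y" if "x \<in> A" "y \<in> A" "r x y" for x y
    using assms(6)[OF that] .
qed

lemma dlo_forest_dual: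
  assumes "dlo_forest A r c"
  shows "dlo_forest A (\<lambda>x y. r y x) c"
proof (rule dlo_forestI)
  show "r z x" if "x \<in> A" "y \<in> A" "z \<in> A" "r y x" "r z y" for x y z
    using dlo_forestD(2)[OF assms] that by blast
  show "c x = c y \<longleftrightarrow> x = y \<or> r y x \<or> r x y" if "x \<in> A" "y \<in> A" for x y
    using dlo_forestD(3)[OF assms that] by blast
  show "\<exists>z\<in>A. r z x \<and> r y z" if "x \<in> A" "y \<in> A" "r y x" for x y
    using dlo_forestD(6)[OF assms that(2,1,3)] by blast
  show "\<not> r x x" if "x \<in> A" for x using dlo_forestD(1)[OF assms that] .
  show "\<exists>y\<in>A. r y x" "\<exists>y\<in>A. r x y" if "x \<in> A" for x
    using dlo_forestD(4,5)[OF assms that] .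
qed

lemma dlo_forest_chain_max:
  assumes "dlo_forest B s d" "finite L" "L \<noteq> {}" "L \<subseteq> B" "\<And>l. l \<in> L \<Longrightarrow> d l = k"
  shows "\<exists>m\<in>L. \<forall>l\<in>L. l = m \<or> s l m"
  using assms(2-5)
proof (induction L rule: finite_ne_induct)
  case (insert x L)
  then obtain m where m: "m \<in> L" "\<forall>l\<in>L. l = m \<or> s l m" by auto
  have B: "x \<in> B" "m \<in> B" "L \<subseteq> B" using insert.prems m(1) by auto
  have "d x = d m" using insert.prems m(1) by simp
  then consider "x = m" | "s x m" | "s m x" using dlo_forestD(3)[OF assms(1) B(1,2)] by blast
  then show ?case
  proof cases
    case 3
    have "l = x \<or> s l x" if "l \<in> insert x L" for l
      using that m 3 B dlo_forestD(2)[OF assms(1), of l m x] by (metis insert_iff subsetD)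
    then show ?thesis by blast
  qed (use m in blast)+
qed simp

text \<open>Comparison with the largest point of \<open>L\<close> and the least point of
  \<open>U\<close> is enough; when both sets are empty, a point exists because \<open>k\<close> is a
  label that occurs.\<close>

lemma dlo_forest_between:
  assumes B: "dlo_forest B s d" and fin: "finite L" "finite U" and sub: "L \<subseteq> B" "U \<subseteq> B"
    and k: "k \<in> d ` B" "\<And>l. l \<in> L \<union> U \<Longrightarrow> d l = k" and lt: "\<And>l u. l \<in> L \<Longrightarrow> u \<in> U \<Longrightarrow> s l u"
  shows "\<exists>y\<in>B. d y = k \<and> (\<forall>l\<in>L. s l y) \<and> (\<forall>u\<in>U. s y u)"
proof -
  note D = dlo_forestD[OF B]
  have max: "\<exists>m\<in>L. \<forall>l\<in>L. l = m \<or> s l m" if "L \<noteq> {}"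
    using dlo_forest_chain_max[OF B fin(1) that sub(1)] k(2) by blast
  have min: "\<exists>m\<in>U. \<forall>l\<in>U. l = m \<or> s m l" if "U \<noteq> {}"
    using dlo_forest_chain_max[OF dlo_forest_dual[OF B] fin(2) that sub(2)] k(2) by blast
  have above: "\<forall>l\<in>L. s l y" if "m \<in> L" "\<forall>l\<in>L. l = m \<or> s l m" "s m y" "y \<in> B" for m y
  proof
    show "s l y" if "l \<in> L" for l
      using \<open>m \<in> L\<close> \<open>\<forall>l\<in>L. l = m \<or> s l m\<close> \<open>s m y\<close> \<open>y \<in> B\<close> \<open>l \<in> L\<close> D(2)[of l m y] sub(1)
      by (metis subsetD)
  qed
  have below: "\<forall>u\<in>U. s y u" if "m \<in> U" "\<forall>u\<in>U. u = m \<or> s m u" "s y m" "y \<in> B" for m y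
  proof
    show "s y u" if "u \<in> U" for u
      using \<open>m \<in> U\<close> \<open>\<forall>u\<in>U. u = m \<or> s m u\<close> \<open>s y m\<close> \<open>y \<in> B\<close> \<open>u \<in> U\<close> D(2)[of y m u] sub(2)
      by (metis subsetD)
  qed
  show ?thesis
  proof (cases "L = {}")
    case L: True
    show ?thesis
    proof (cases "U = {}")
      case True
      then show ?thesis using L k(1) by blast
    next
      case False
      obtain m where m: "m \<in> U" "\<forall>u\<in>U. u = m \<or> s m u" using min[OF False] by blast
      then obtain y where y: "y \<in> B" "s y m" using D(4) sub(2) by blast
      have "d y = k" using D(3)[OF y(1), of m] y(2) m(1) sub(2) k(2) by auto
      then show ?thesis using below[OF m y(2,1)] y(1) L by blast
    qed
  next
    case False
    obtain m where m: "m \<in> L" "\<forall>l\<in>L. l = m \<or> s l m" using max[OF False] by blast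
    have mB: "m \<in> B" using m(1) sub(1) by blast
    show ?thesis
    proof (cases "U = {}")
      case True
      then obtain y where y: "y \<in> B" "s m y" using D(5)[OF mB] by blast
      have "d y = k" using D(3)[OF y(1) mB] y(2) m(1) k(2) by auto
      then show ?thesis using above[OF m y(2,1)] y(1) True by blast
    next
      case False
      obtain n where n: "n \<in> U" "\<forall>u\<in>U. u = n \<or> s n u" using min[OF False] by blast
      have nB: "n \<in> B" using n(1) sub(2) by blast
      obtain y where y: "y \<in> B" "s m y" "s y n" using D(6)[OF mB nB lt[OF m(1) n(1)]] by blast
      have "d y = k" using D(3)[OF y(1) mB] y(2) m(1) k(2) by auto
      then show ?thesis using above[OF m y(2,1)] below[OF n y(3,1)] y(1) by blast
    qed
  qed
qed

definition same_labelled where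
  "same_labelled r c s d x y x' y' \<longleftrightarrow> same r s x y x' y' \<and> c x = d y \<and> c x' = d y'"

text \<open>Points comparable with \<open>x\<close> carry its label, so their partners lie in the
  component of \<open>B\<close> named \<open>c x\<close>, and the partner of \<open>x\<close> is
  placed there between them. Points with other labels are incomparable to it on both sides.\<close>

lemma dlo_forest_forth:
  assumes A: "dlo_forest A r c" and B: "dlo_forest B s d" and lab: "c ` A \<subseteq> d ` B"
    and S: "finite S" "S \<subseteq> A \<times> B" "coherent (same_labelled r c s d) S" and x: "x \<in> A"
  shows "\<exists>y\<in>B. coherent (same_labelled r c s d) (insert (x, y) S)"
proof (cases "x \<in> fst ` S")
  case True
  then obtain y where "(x, y) \<in> S" by force
  then show ?thesis using S by (intro bexI[of _ y]) (auto simp: insert_absorb)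
next
  case False
  have coh: "same_labelled r c s d a b a' b'" if "(a, b) \<in> S" "(a', b') \<in> S" for a b a' b'
    using S(3) that unfolding coherent_def by blast
  have AB: "a \<in> A" "b \<in> B" if "(a, b) \<in> S" for a b using S(2) that by auto
  have eqlab: "c a = d b" if "(a, b) \<in> S" for a b
    using coh[OF that that] unfolding same_labelled_def by blast
  define L where "L = {b. \<exists>a. (a, b) \<in> S \<and> r a x}"
  define U where "U = {b. \<exists>a. (a, b) \<in> S \<and> r x a}"
  have "L \<subseteq> snd ` S" "U \<subseteq> snd ` S" unfolding L_def U_def by force+
  then have fin: "finite L" "finite U" using S(1) finite_surj by blast+
  have "\<exists>y\<in>B. d y = c x \<and> (\<forall>l\<in>L. s l y) \<and> (\<forall>u\<in>U. s y u)"
  proof (rule dlo_forest_between[OF B fin])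
    show "L \<subseteq> B" "U \<subseteq> B" using AB unfolding L_def U_def by auto
    show "c x \<in> d ` B" using x lab by blast
    show "d l = c x" if "l \<in> L \<union> U" for l
      using that dlo_forestD(3)[OF A x] AB eqlab unfolding L_def U_def by fastforce
    show "s l u" if lu: "l \<in> L" "u \<in> U" for l u
    proof -
      obtain a where a: "(a, l) \<in> S" "r a x" using lu(1) unfolding L_def by blast
      obtain b where b: "(b, u) \<in> S" "r x b" using lu(2) unfolding U_def by blast
      have "r a b" using dlo_forestD(2)[OF A _ x _ a(2) b(2)] a(1) b(1) AB by blast
      then show ?thesis using coh[OF a(1) b(1)] unfolding same_labelled_def same_def by blast
    qed
  qed
  then obtain y where y: "y \<in> B" "d y = c x" "\<And>l. l \<in> L \<Longrightarrow> s l y" "\<And>u. u \<in> U \<Longrightarrow> s y u" by blast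
  have "same r s x y a b" if ab: "(a, b) \<in> S" for a b
  proof -
    have "x \<noteq> a" using False ab by force
    note A3 = dlo_forestD(3)[OF A x AB(1)[OF ab]] and B3 = dlo_forestD(3)[OF B y(1) AB(2)[OF ab]]
    consider "r a x" | "r x a" | "c x \<noteq> c a" using A3 \<open>x \<noteq> a\<close> by blast
    then show ?thesis
    proof cases
      case 1
      then have "s b y" using y(3) ab unfolding L_def by blast
      moreover have "\<not> r x a" using 1 dlo_forestD(1)[OF A x] dlo_forestD(2)[OF A x _ x, of a] AB[OF ab] by blast
      moreover have "\<not> s y b" "y \<noteq> b" using \<open>s b y\<close> dlo_forestD(1)[OF B y(1)] dlo_forestD(2)[OF B y(1) _ y(1), of b] AB[OF ab] by blast+
      ultimately show ?thesis using 1 \<open>x \<noteq> a\<close> unfolding same_def by blast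
    next
      case 2
      then have "s y b" using y(4) ab unfolding U_def by blast
      moreover have "\<not> r a x" using 2 dlo_forestD(1)[OF A x] dlo_forestD(2)[OF A x _ x, of a] AB[OF ab] by blast
      moreover have "\<not> s b y" "y \<noteq> b" using \<open>s y b\<close> dlo_forestD(1)[OF B y(1)] dlo_forestD(2)[OF B y(1) _ y(1), of b] AB[OF ab] by blast+
      ultimately show ?thesis using 2 \<open>x \<noteq> a\<close> unfolding same_def by blast
    next
      case 3
      then have "d y \<noteq> d b" using y(2) eqlab[OF ab] by simp
      then show ?thesis using 3 A3 B3 unfolding same_def by blast
    qed
  qed
  then have "same_labelled r c s d x y a b" "same_labelled r c s d a b x y" if "(a, b) \<in> S" for a b
    using that eqlab y(2) same_sym unfolding same_labelled_def by metis+
  moreover have "same_labelled r c s d x y x y"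
    using y(2) dlo_forestD(1)[OF A x] dlo_forestD(1)[OF B y(1)]
    unfolding same_labelled_def same_def by simp
  ultimately show ?thesis using S(3) y(1) unfolding coherent_def by (intro bexI[of _ y]) auto
qed

lemma dlo_forest_isomorphic_same_labels:
  assumes A: "dlo_forest A r c" "countable A" and B: "dlo_forest B s d" "countable B"
    and lab: "c ` A = d ` B"
  shows "isomorphic A r B s"
proof -
  have "\<exists>f. bij_betw f A B \<and> (\<forall>x\<in>A. \<forall>x'\<in>A. same_labelled r c s d x (f x) x' (f x'))"
  proof (rule back_and_forth[OF A(2) B(2)])
    show "x = x' \<longleftrightarrow> y = y'" if "same_labelled r c s d x y x' y'" for x y x' y'
      using that unfolding same_labelled_def same_def by blast
    fix S assume S: "finite S" "S \<subseteq> A \<times> B" "coherent (same_labelled r c s d) S"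
    show "\<exists>y\<in>B. coherent (same_labelled r c s d) (insert (x, y) S)" if "x \<in> A" for x
      using dlo_forest_forth[OF A(1) B(1) _ S that] lab by blast
    \<comment> \<open>The step back is the step forth for the converse relation.\<close>
    have "same_labelled s d r c y x y' x' \<longleftrightarrow> same_labelled r c s d x y x' y'" for x y x' y'
      unfolding same_labelled_def same_def by auto
    then have conv: "coherent (same_labelled r c s d) T \<longleftrightarrow> coherent (same_labelled s d r c) (T\<inverse>)" for T
      by (simp add: coherent_def Ball_def split_paired_All) blast
    show "\<exists>x\<in>A. coherent (same_labelled r c s d) (insert (x, y) S)" if yB: "y \<in> B" for y
    proof -
      have "finite (S\<inverse>)" "S\<inverse> \<subseteq> B \<times> A" using S by auto
      then obtain x where "x \<in> A" "coherent (same_labelled s d r c) (insert (y, x) (S\<inverse>))"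
        using dlo_forest_forth[OF B(1) A(1) _ _ _ _ yB, of "S\<inverse>"] lab S(3) conv by blast
      moreover have "insert (y, x) (S\<inverse>) = (insert (x, y) S)\<inverse>" by blast
      ultimately show ?thesis using conv by metis
    qed
  qed
  then show ?thesis
    unfolding isomorphic_def rel_iso_def same_labelled_def same_def by blast
qed

text \<open>Relabelling along a bijection of the label sets shows that the number of components
  determines the isomorphism type of a countable order of this kind.\<close>

lemma dlo_forest_isomorphic:
  assumes A: "dlo_forest A r c" "countable A" and B: "dlo_forest B s d" "countable B"
    and "c ` A \<approx> d ` B"
  shows "isomorphic A r B s"
proof -
  obtain \<phi> where \<phi>: "bij_betw \<phi> (c ` A) (d ` B)" using assms(5) unfolding eqpoll_def by blast
  have "(\<phi> \<circ> c) x = (\<phi> \<circ> c) y \<longleftrightarrow> c x = c y" if "x \<in> A" "y \<in> A" for x y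
    using \<phi> that unfolding bij_betw_def inj_on_def by auto
  then have "dlo_forest A r (\<phi> \<circ> c)"
    using A(1) unfolding dlo_forest_def by simp
  moreover have "(\<phi> \<circ> c) ` A = d ` B" using \<phi> unfolding bij_betw_def by (simp add: image_comp)
  ultimately show ?thesis by (rule dlo_forest_isomorphic_same_labels[OF _ A(2) B])
qed

text \<open>Two labellings of one order have the same kernel, namely comparability.\<close>

lemma dlo_forest_labels:
  assumes "dlo_forest A r c" "dlo_forest A r c'"
  shows "c ` A \<approx> c' ` A"
proof -
  have ker: "c x = c y \<longleftrightarrow> c' x = c' y" if "x \<in> A" "y \<in> A" for x y
    using dlo_forestD(3)[OF assms(1) that] dlo_forestD(3)[OF assms(2) that] by blast
  define \<phi> where "\<phi> k = c' (inv_into A c k)" for k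
  have \<phi>: "\<phi> (c x) = c' x" if "x \<in> A" for x
    using ker[of "inv_into A c (c x)" x] that unfolding \<phi>_def
    by (simp add: inv_into_into f_inv_into_f)
  have "bij_betw \<phi> (c ` A) (c' ` A)"
    unfolding bij_betw_def
  proof
    show "inj_on \<phi> (c ` A)" using \<phi> ker by (auto simp: inj_on_def)
    show "\<phi> ` c ` A = c' ` A" unfolding image_image using \<phi> by (rule image_cong[OF refl])
  qed
  then show ?thesis unfolding eqpoll_def by blast
qed

lemma dlo_forest_transfer:
  assumes f: "rel_iso A r B s f" and B: "dlo_forest B s d"
  shows "dlo_forest A r (d \<circ> f)"
proof -
  have fB: "f x \<in> B" if "x \<in> A" for x using f that unfolding rel_iso_def bij_betw_def by blast
  have rs: "r x y \<longleftrightarrow> s (f x) (f y)" "f x = f y \<longleftrightarrow> x = y" if "x \<in> A" "y \<in> A" for x y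
    using f that unfolding rel_iso_def bij_betw_def inj_on_def by blast+
  have sur: "\<exists>x\<in>A. f x = y" if "y \<in> B" for y
    using f that unfolding rel_iso_def bij_betw_def by blast
  note D = dlo_forestD[OF B]
  show ?thesis
  proof (rule dlo_forestI)
    show "\<not> r x x" if "x \<in> A" for x using rs[OF that that] D(1) fB that by blast
    show "r x z" if "x \<in> A" "y \<in> A" "z \<in> A" "r x y" "r y z" for x y z
      using D(2)[OF fB fB fB] rs that by blast
    show "(d \<circ> f) x = (d \<circ> f) y \<longleftrightarrow> x = y \<or> r x y \<or> r y x" if "x \<in> A" "y \<in> A" for x y
      using D(3)[OF fB fB] rs that by simp
    show "\<exists>y\<in>A. r y x" if "x \<in> A" for x using D(4)[OF fB[OF that]] sur rs that by metis
    show "\<exists>y\<in>A. r x y" if "x \<in> A" for x using D(5)[OF fB[OF that]] sur rs that by metis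
    show "\<exists>z\<in>A. r x z \<and> r z y" if "x \<in> A" "y \<in> A" "r x y" for x y
      using D(6)[OF fB[OF that(1)] fB[OF that(2)]] sur rs that by metis
  qed
qed

text \<open>A copy has two labellings, the inherited one and the one pulled back along an
  isomorphism with \<open>X\<close>; comparing them counts the components it meets. Conversely, that
  count fixes the isomorphism type.\<close>

lemma dlo_forest_copies:
  assumes X: "dlo_forest X r c" "countable X"
  shows "B \<in> copies X r \<longleftrightarrow> B \<subseteq> X \<and> dlo_forest B r c \<and> c ` B \<approx> c ` X"
proof
  assume "B \<in> copies X r"
  then obtain f where f: "rel_iso B r X r f" and BX: "B \<subseteq> X"
    unfolding copies_def isomorphic_def by blast
  have B: "dlo_forest B r (c \<circ> f)" by (rule dlo_forest_transfer[OF f X(1)])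
  have "dlo_forest B r c"
  proof (rule dlo_forestI)
    show "c x = c y \<longleftrightarrow> x = y \<or> r x y \<or> r y x" if "x \<in> B" "y \<in> B" for x y
      using dlo_forestD(3)[OF X(1)] that BX by blast
  qed (use dlo_forestD[OF B] in blast)+
  moreover have "(c \<circ> f) ` B = c ` X"
    using f unfolding rel_iso_def bij_betw_def by (metis image_comp)
  ultimately show "B \<subseteq> X \<and> dlo_forest B r c \<and> c ` B \<approx> c ` X"
    using BX dlo_forest_labels[OF _ B] by metis
next
  assume B: "B \<subseteq> X \<and> dlo_forest B r c \<and> c ` B \<approx> c ` X"
  then have "countable B" using countable_subset[OF _ X(2)] by blast
  then have "isomorphic B r X r" using dlo_forest_isomorphic[of B r c X r c] B X by blast
  then show "B \<in> copies X r" using B unfolding copies_def by blast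
qed

text \<open>Density passes to convex subsets, so only the absence of endpoints has to be
  supplied.\<close>

lemma dlo_forest_convex:
  assumes B: "dlo_forest B r c" and "A \<subseteq> B"
    and "\<And>x. x \<in> A \<Longrightarrow> (\<exists>y\<in>A. r y x) \<and> (\<exists>y\<in>A. r x y)"
    and "\<And>x y z. x \<in> A \<Longrightarrow> z \<in> A \<Longrightarrow> y \<in> B \<Longrightarrow> r x y \<Longrightarrow> r y z \<Longrightarrow> y \<in> A"
  shows "dlo_forest A r c"
proof (rule dlo_forestI)
  show "\<exists>z\<in>A. r x z \<and> r z y" if "x \<in> A" "y \<in> A" "r x y" for x y
    using dlo_forestD(6)[OF B, of x y] that assms(2,4) by blast
  show "r x z" if "x \<in> A" "y \<in> A" "z \<in> A" "r x y" "r y z" for x y z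
    using dlo_forestD(2)[OF B, of x y z] that assms(2) by blast
  show "c x = c y \<longleftrightarrow> x = y \<or> r x y \<or> r y x" if "x \<in> A" "y \<in> A" for x y
    using dlo_forestD(3)[OF B, of x y] that assms(2) by blast
  show "\<not> r x x" if "x \<in> A" for x using dlo_forestD(1)[OF B] that assms(2) by blast
  show "\<exists>y\<in>A. r y x" "\<exists>y\<in>A. r x y" if "x \<in> A" for x
    using assms(3)[OF that] by simp_all
qed

text \<open>Comparable points share a label and hence lie in the same \<open>D i\<close>, where
  density applies.\<close>

lemma dlo_forest_Union:
  assumes D: "\<And>i. i \<in> I \<Longrightarrow> dlo_forest (D i) r c \<and> c ` D i \<subseteq> {i}"
    and X: "dlo_forest X r c" and sub: "\<And>i. i \<in> I \<Longrightarrow> D i \<subseteq> X"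
  shows "dlo_forest (\<Union>i\<in>I. D i) r c"
proof -
  have DX: "(\<Union>i\<in>I. D i) \<subseteq> X" using sub by blast
  show ?thesis
  proof (rule dlo_forestI)
    show "\<not> r x x" if "x \<in> (\<Union>i\<in>I. D i)" for x using dlo_forestD(1)[OF X] that DX by blast
    show "r x z" if "x \<in> (\<Union>i\<in>I. D i)" "y \<in> (\<Union>i\<in>I. D i)" "z \<in> (\<Union>i\<in>I. D i)" "r x y" "r y z" for x y z
      using dlo_forestD(2)[OF X, of x y z] that DX by blast
    show eq: "c x = c y \<longleftrightarrow> x = y \<or> r x y \<or> r y x"
      if "x \<in> (\<Union>i\<in>I. D i)" "y \<in> (\<Union>i\<in>I. D i)" for x y
      using dlo_forestD(3)[OF X, of x y] that DX by blast
    show "\<exists>y\<in>(\<Union>i\<in>I. D i). r y x" if x: "x \<in> (\<Union>i\<in>I. D i)" for x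
    proof -
      obtain i where i: "i \<in> I" "x \<in> D i" using x by blast
      then show ?thesis using dlo_forestD(4)[of "D i" r c x] D by blast
    qed
    show "\<exists>y\<in>(\<Union>i\<in>I. D i). r x y" if x: "x \<in> (\<Union>i\<in>I. D i)" for x
    proof -
      obtain i where i: "i \<in> I" "x \<in> D i" using x by blast
      then show ?thesis using dlo_forestD(5)[of "D i" r c x] D by blast
    qed
    show "\<exists>z\<in>(\<Union>i\<in>I. D i). r x z \<and> r z y"
      if xy: "x \<in> (\<Union>i\<in>I. D i)" "y \<in> (\<Union>i\<in>I. D i)" "r x y" for x y
    proof -
      obtain i where i: "i \<in> I" "x \<in> D i" using xy(1) by blast
      obtain j where j: "j \<in> I" "y \<in> D j" using xy(2) by blast
      have "c x = c y" using eq xy by blast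
      moreover have "c x = i" "c y = j" using D i j by auto
      ultimately have "y \<in> D i" using j by simp
      then show ?thesis using dlo_forestD(6)[of "D i" r c x y] D i xy(3) by blast
    qed
  qed
qed

text \<open>The diagonal copy takes one new block from each member of the antichain, avoiding the
  finitely many blocks on which that member has a large overlap with an earlier one.\<close>

lemma no_countable_maximal_antichain:
  fixes c :: "'a \<Rightarrow> 'b" and G :: "'a set \<Rightarrow> bool"
  assumes cop: "\<And>B. B \<in> copies X r \<longleftrightarrow> B \<subseteq> X \<and> G B \<and> infinite (c ` B)"
    and restr: "\<And>B k. B \<subseteq> X \<Longrightarrow> G B \<Longrightarrow> G {x \<in> B. c x = k}"
    and union: "\<And>D I. (\<And>i. i \<in> I \<Longrightarrow> D i \<subseteq> X \<and> G (D i) \<and> c ` D i \<subseteq> {i}) \<Longrightarrow> G (\<Union>i\<in>I. D i)"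
    and C: "maximal_antichain_in (copies X r) (\<subseteq>) C" "countable C" "infinite C"
  shows False
proof -
  define A where "A = from_nat_into C"
  have bijA: "bij_betw A UNIV C" unfolding A_def by (rule bij_betw_from_nat_into[OF C(2,3)])
  have AC: "A n \<in> C" for n using bijA unfolding bij_betw_def by blast
  have A: "A n \<subseteq> X" "G (A n)" "infinite (c ` A n)" for n
    using AC[of n] C(1) cop unfolding maximal_antichain_in_def antichain_in_def by blast+
  \<comment> \<open>The labels at which two members of the antichain share an admissible block.
    Infinitely many such blocks would unite to a common lower bound.\<close>
  define bad where "bad m n = {k. \<exists>D. D \<noteq> {} \<and> D \<subseteq> A m \<inter> A n \<and> c ` D \<subseteq> {k} \<and> G D}" for m n
  have fin: "finite (bad m n)" if "m \<noteq> n" for m n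
  proof (rule ccontr)
    assume inf: "infinite (bad m n)"
    have "\<forall>k\<in>bad m n. \<exists>D. D \<noteq> {} \<and> D \<subseteq> A m \<inter> A n \<and> c ` D \<subseteq> {k} \<and> G D"
      unfolding bad_def by blast
    from bchoice[OF this] obtain D where
      D: "\<forall>k\<in>bad m n. D k \<noteq> {} \<and> D k \<subseteq> A m \<inter> A n \<and> c ` D k \<subseteq> {k} \<and> G (D k)" ..
    have "G (\<Union>k\<in>bad m n. D k)" using D A(1) by (intro union) blast
    moreover have "bad m n \<subseteq> c ` (\<Union>k\<in>bad m n. D k)" using D by fast
    then have "infinite (c ` (\<Union>k\<in>bad m n. D k))" using inf finite_subset by blast
    moreover have sub: "(\<Union>k\<in>bad m n. D k) \<subseteq> A m \<inter> A n" using D by blast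
    ultimately have "(\<Union>k\<in>bad m n. D k) \<in> copies X r" using cop A(1) by blast
    then have "compatible_in (copies X r) (\<subseteq>) (A m) (A n)"
      using sub unfolding compatible_in_def by blast
    moreover have "A m \<noteq> A n" using bijA that unfolding bij_betw_def inj_def by blast
    ultimately show False
      using C(1) AC unfolding maximal_antichain_in_def antichain_in_def by blast
  qed
  define J where "J n = c ` A n - (\<Union>m<n. bad m n)" for n
  have "infinite (id ` J n)" for n
  proof -
    have "finite (\<Union>m<n. bad m n)" using fin by auto
    then show ?thesis using A(3)[of n] unfolding J_def by simp
  qed
  then obtain i where i: "\<forall>n. i n \<in> J n" "inj (\<lambda>n. id (i n))"
    using ex_injective_choice[of id J] by blast
  then have inji: "inj i" by simp
  \<comment> \<open>Blocks are indexed by their labels, as \<open>union\<close> requires;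
    \<open>inv i\<close> recovers the member from which the block is taken.\<close>
  define D where "D k = {x \<in> A (inv i k). c x = k}" for k
  define B where "B = (\<Union>k\<in>range i. D k)"
  have Di: "D (i n) = {x \<in> A n. c x = i n}" for n
    unfolding D_def using inv_f_f[OF inji] by simp
  have "G B" unfolding B_def
  proof (rule union)
    fix k show "D k \<subseteq> X \<and> G (D k) \<and> c ` D k \<subseteq> {k}"
      using restr A(1,2) unfolding D_def by blast
  qed
  moreover have "range i \<subseteq> c ` B"
  proof
    fix k assume "k \<in> range i"
    then obtain n where n: "k = i n" by blast
    then have "k \<in> c ` A n" using i(1) unfolding J_def by blast
    then show "k \<in> c ` B" using Di[of n] n unfolding B_def by blast
  qed
  then have "infinite (c ` B)" using range_inj_infinite[OF inji] finite_subset by blast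
  moreover have "B \<subseteq> X" using A(1) unfolding B_def D_def by blast
  ultimately have "B \<in> copies X r" using cop by blast
  then obtain a where a: "a \<in> C" "compatible_in (copies X r) (\<subseteq>) B a"
    using C(1) unfolding maximal_antichain_in_def by blast
  obtain m where m: "a = A m" using a(1) bijA unfolding bij_betw_def by blast
  obtain E where E: "E \<in> copies X r" "E \<subseteq> B" "E \<subseteq> A m"
    using a(2) m unfolding compatible_in_def by blast
  have EX: "E \<subseteq> X" "G E" "infinite (c ` E)" using E(1) cop by blast+
  \<comment> \<open>A common copy of \<open>B\<close> and \<open>A m\<close> uses infinitely many
    labels, hence some \<open>i n\<close> with \<open>n\<close> beyond \<open>m\<close>. Its block
    there also lies in \<open>A n\<close>, although \<open>i n\<close> was chosen outside
    \<open>bad m n\<close>.\<close>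
  have "\<exists>n>m. i n \<in> c ` E"
  proof (rule ccontr)
    assume no: "\<not> (\<exists>n>m. i n \<in> c ` E)"
    have "c ` E \<subseteq> i ` {..m}"
    proof
      fix k assume k: "k \<in> c ` E"
      then obtain x where x: "x \<in> E" "c x = k" by blast
      then obtain n where "x \<in> D (i n)" using E(2) unfolding B_def by blast
      then have "k = i n" using x(2) Di by blast
      then show "k \<in> i ` {..m}" using no k by (metis atMost_iff imageI not_le)
    qed
    then show False using EX(3) finite_subset by blast
  qed
  then obtain n where n: "n > m" "i n \<in> c ` E" by blast
  define F where "F = {x \<in> E. c x = i n}"
  have "F \<subseteq> A n"
  proof
    fix x assume x: "x \<in> F"
    then obtain n' where "x \<in> D (i n')" using E(2) unfolding B_def F_def by blast
    then have "c x = i n'" "x \<in> A n'" using Di by blast+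
    then show "x \<in> A n" using x inji unfolding F_def inj_def by auto
  qed
  moreover have "G F" unfolding F_def using restr EX by blast
  moreover obtain x where "x \<in> E" "c x = i n" using n(2) by (metis imageE)
  then have "x \<in> F" unfolding F_def by simp
  then have "F \<noteq> {}" by blast
  moreover have "F \<subseteq> A m" "c ` F \<subseteq> {i n}" using E(3) unfolding F_def by auto
  ultimately have "i n \<in> bad m n"
    unfolding bad_def by (intro CollectI exI[of _ F]) simp
  then show False using i(1)[rule_format, of n] n(1) unfolding J_def by blast
qed

section \<open>Orders with transitive incomparability or comparability\<close>

context hposet_ne
begin

text \<open>Iterated density gives an increasing sequence in the interval, and \<open>e\<close>
  separates comparable points.\<close>

lemma infinite_interval:
  assumes "\<And>x y. x \<sqsubset> y \<Longrightarrow> e x \<noteq> e y" "a \<sqsubset> b"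
  shows "infinite (e ` {y. a \<sqsubset> y \<and> y \<sqsubset> b})"
proof -
  have "\<exists>f. \<forall>n. (a \<sqsubset> f n \<and> f n \<sqsubset> b) \<and> f n \<sqsubset> f (Suc n)"
  proof (rule dependent_nat_choice)
    show "\<exists>x. a \<sqsubset> x \<and> x \<sqsubset> b" by (rule dense[OF assms(2)])
    show "\<exists>y. (a \<sqsubset> y \<and> y \<sqsubset> b) \<and> x \<sqsubset> y" if x: "a \<sqsubset> x \<and> x \<sqsubset> b" for x and n :: nat
      using dense[of x b] x tr by blast
  qed
  then obtain f :: "nat \<Rightarrow> 'a" where f: "\<forall>n. (a \<sqsubset> f n \<and> f n \<sqsubset> b) \<and> f n \<sqsubset> f (Suc n)" ..
  have "f m \<sqsubset> f n" if "m < n" for m n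
    using that
  proof (induction n)
    case (Suc n)
    then show ?case using f[rule_format, of n] tr by (metis less_Suc_eq)
  qed simp
  then have "inj (\<lambda>n. e (f n))" using assms(1) by (intro injI) (metis linorder_neqE_nat)
  then have "infinite (range (\<lambda>n. e (f n)))" by (rule range_inj_infinite)
  moreover have "range (\<lambda>n. e (f n)) \<subseteq> e ` {y. a \<sqsubset> y \<and> y \<sqsubset> b}" using f by blast
  ultimately show ?thesis using finite_subset by blast
qed

text \<open>An interval around \<open>x\<close> is chosen so tight that it lies on the same side as
  \<open>x\<close> of every point of \<open>F\<close> comparable with \<open>x\<close>;
  \<open>near\<close> covers the incomparable ones.\<close>

lemma infinite_realizations_interval:
  assumes e: "\<And>x y. x \<sqsubset> y \<Longrightarrow> e x \<noteq> e y" and F: "finite F" "x \<in> X"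
    and near: "\<And>f a b y. f \<in> F \<Longrightarrow> f \<bowtie> x \<Longrightarrow> a \<sqsubset> x \<Longrightarrow> x \<sqsubset> b \<Longrightarrow> a \<sqsubset> y \<Longrightarrow> y \<sqsubset> b \<Longrightarrow> f \<bowtie> y"
    and "x \<notin> F"
  shows "infinite (e ` realizations F x)"
proof -
  have "\<exists>a. a \<sqsubset> x \<and> (\<forall>l\<in>{f \<in> F. f \<sqsubset> x}. l \<sqsubset> a)"
    by (rule between_left) (use F in simp_all)
  then obtain a where a: "a \<sqsubset> x" "\<forall>l\<in>{f \<in> F. f \<sqsubset> x}. l \<sqsubset> a" by blast
  have "\<exists>b. x \<sqsubset> b \<and> (\<forall>u\<in>{f \<in> F. x \<sqsubset> f}. b \<sqsubset> u)"
    by (rule between_right) (use F in simp_all)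
  then obtain b where b: "x \<sqsubset> b" "\<forall>u\<in>{f \<in> F. x \<sqsubset> f}. b \<sqsubset> u" by blast
  have "{y. a \<sqsubset> y \<and> y \<sqsubset> b} \<subseteq> realizations F x"
  proof
    fix y assume "y \<in> {y. a \<sqsubset> y \<and> y \<sqsubset> b}"
    then have y: "a \<sqsubset> y" "y \<sqsubset> b" by auto
    have "y \<noteq> z \<and> (y \<sqsubset> z \<longleftrightarrow> x \<sqsubset> z) \<and> (z \<sqsubset> y \<longleftrightarrow> z \<sqsubset> x)" if z: "z \<in> F" for z
    proof -
      consider "z \<sqsubset> x" | "x \<sqsubset> z" | "z \<bowtie> x" using z \<open>x \<notin> F\<close> by blast
      then show ?thesis
      proof cases
        case 1
        then have "z \<sqsubset> y" using a(2) z y(1) tr by blast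
        then show ?thesis using 1 asym irr by blast
      next
        case 2
        then have "y \<sqsubset> z" using b(2) z y(2) tr by blast
        then show ?thesis using 2 asym irr by blast
      next
        case 3
        then show ?thesis using near[OF z 3 a(1) b(1) y] by blast
      qed
    qed
    then show "y \<in> realizations F x" using y fld unfolding realizations_def by blast
  qed
  moreover have "a \<sqsubset> b" using a b tr by blast
  ultimately show ?thesis
    using infinite_interval[of e a b] e by (meson finite_subset image_mono)
qed

end

section \<open>Orders with transitive incomparability\<close>

locale hposet_weak = hposet_ne +
  assumes incomp_trans: "{x, y, z} \<subseteq> X \<Longrightarrow> x \<bowtie> y \<Longrightarrow> y \<bowtie> z \<Longrightarrow> x = z \<or> x \<bowtie> z"
begin

text \<open>Whatever lies above one of two incomparable points lies above the other, and likewise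
  below.\<close>

lemma directed: "hposet_dir X r"
proof
  show "\<exists>u. x \<sqsubset> u \<and> y \<sqsubset> u" if xy: "x \<in> X" "y \<in> X" for x y
  proof -
    obtain u where u: "x \<sqsubset> u" using above[OF xy(1)] by blast
    obtain v where v: "y \<sqsubset> v" using above[OF xy(2)] by blast
    show ?thesis
    proof (cases "x \<bowtie> y")
      case True
      then have "y \<sqsubset> u" using incomp_trans[of x y u] u xy fld[OF u] tr[of x u y] irr by (metis empty_subsetI insert_subset)
      then show ?thesis using u by blast
    next
      case False
      then show ?thesis using u v tr by blast
    qed
  qed
  show "\<exists>u. u \<sqsubset> x \<and> u \<sqsubset> y" if xy: "x \<in> X" "y \<in> X" for x y
  proof -
    obtain u where u: "u \<sqsubset> x" using below[OF xy(1)] by blast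
    obtain v where v: "v \<sqsubset> y" using below[OF xy(2)] by blast
    show ?thesis
    proof (cases "x \<bowtie> y")
      case True
      then have "u \<sqsubset> y" using incomp_trans[of x y u] u xy fld[OF u] tr[of y u x] irr by (metis empty_subsetI insert_subset)
      then show ?thesis using u by blast
    next
      case False
      then show ?thesis using u v tr by blast
    qed
  qed
qed

lemma continuum_antichain_weak:
  "\<exists>C. maximal_antichain_in (copies X r) (\<subseteq>) C \<and> C \<approx> (UNIV :: nat set set)"
proof -
  define e where "e x = {y \<in> X. y = x \<or> y \<bowtie> x}" for x
  have e: "e x \<noteq> e y" if "x \<sqsubset> y" for x y
  proof -
    have "x \<in> e x" "x \<notin> e y" using that fld[OF that] irr unfolding e_def by auto
    then show ?thesis by blast
  qed
  have sub: "e x \<subseteq> e y" if "x \<bowtie> y" "x \<in> X" "y \<in> X" for x y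
  proof
    fix z assume "z \<in> e x"
    then show "z \<in> e y" using that incomp_trans[of z x y] unfolding e_def by blast
  qed
  have eq: "e x = e y" if "x \<bowtie> y" "x \<in> X" "y \<in> X" for x y
    using sub[of x y] sub[of y x] that by blast
  show ?thesis
  proof (rule continuum_antichain[of e])
    show "infinite (e ` realizations F x)"
      if F: "finite F" "F \<subseteq> X" "x \<in> X" "e x \<notin> e ` F" for F x
    proof (rule infinite_realizations_interval[OF e F(1,3)])
      \<comment> \<open>A point of \<open>F\<close> incomparable to \<open>x\<close> would have the
        same class, against the choice of \<open>x\<close>.\<close>
      have "\<not> f \<bowtie> x" if "f \<in> F" for f using eq[of f x] F that by blast
      then show "f \<bowtie> y" if "f \<in> F" "f \<bowtie> x" for f y using that by blast
      show "x \<notin> F" using F(4) by blast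
    qed
    show "infinite (e ` B)" if B: "B \<in> copies X r" for B
    proof -
      obtain f where f: "rel_iso X r B r f" using copies_iso[OF B] .
      obtain a b where ab: "a \<sqsubset> b" using ne by blast
      have "e (f x) \<noteq> e (f y)" if "x \<sqsubset> y" for x y
        using e f that fld[OF that] unfolding rel_iso_def by blast
      then have "infinite ((\<lambda>x. e (f x)) ` {y. a \<sqsubset> y \<and> y \<sqsubset> b})"
        using infinite_interval[of "\<lambda>x. e (f x)" a b] ab by blast
      moreover have "(\<lambda>x. e (f x)) ` {y. a \<sqsubset> y \<and> y \<sqsubset> b} \<subseteq> e ` B"
        using f fld unfolding rel_iso_def bij_betw_def by blast
      ultimately show ?thesis using finite_subset by blast
    qed
  qed
qed

text \<open>The class of \<open>d\<close> consists of minimal points of the slice, so the copy used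
  is the open interval from \<open>d\<close> to \<open>e\<close>. A slice point with a predecessor
  not below \<open>d\<close> lies above \<open>d\<close> and thus in that interval.\<close>

lemma countable_antichain_weak:
  "\<exists>C. maximal_antichain_in (copies X r) (\<subseteq>) C \<and> countable C \<and> infinite C"
proof -
  interpret hposet_dir X r by (rule directed)
  show ?thesis
  proof (rule countable_antichain_directed)
    fix d e assume de: "d \<sqsubset> e"
    have "d \<sqsubset> x" if "y \<sqsubset> x" "\<not> y \<sqsubset> d" for x y
    proof (rule ccontr)
      assume "\<not> d \<sqsubset> x"
      then have "x \<bowtie> d" using that tr by blast
      moreover have "y \<bowtie> d" using \<open>\<not> d \<sqsubset> x\<close> that tr by blast
      ultimately show False using incomp_trans[of y d x] that(1) fld de irr by blast
    qed
    then have "{x. x \<sqsubset> e \<and> (\<exists>y. y \<sqsubset> x \<and> \<not> y \<sqsubset> d)} \<subseteq> {x. d \<sqsubset> x \<and> x \<sqsubset> e}" by blast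
    moreover have "{x. d \<sqsubset> x \<and> x \<sqsubset> e} \<subseteq> {x. x \<sqsubset> e \<and> \<not> x \<sqsubset> d}" using asym by blast
    ultimately show "\<exists>M\<in>copies X r.
      {x. x \<sqsubset> e \<and> (\<exists>y. y \<sqsubset> x \<and> \<not> y \<sqsubset> d)} \<subseteq> M \<and> M \<subseteq> {x. x \<sqsubset> e \<and> \<not> x \<sqsubset> d}"
      using interval_copy[OF de] by blast
  qed
qed

end

section \<open>Disjoint unions of chains\<close>

locale hposet_forest = hposet_ne +
  assumes no_vee: "x \<sqsubset> y \<Longrightarrow> x \<sqsubset> z \<Longrightarrow> \<not> y \<bowtie> z"
    and no_wedge: "y \<sqsubset> x \<Longrightarrow> z \<sqsubset> x \<Longrightarrow> \<not> y \<bowtie> z"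
begin

definition comp where "comp x = {y \<in> X. y = x \<or> x \<sqsubset> y \<or> y \<sqsubset> x}"

text \<open>Without vees and wedges comparability is transitive, so the sets \<open>comp x\<close>
  are its classes.\<close>

lemma comp_eq: "x \<in> X \<Longrightarrow> y \<in> X \<Longrightarrow> comp x = comp y \<longleftrightarrow> x = y \<or> x \<sqsubset> y \<or> y \<sqsubset> x"
proof
  show "comp x = comp y \<Longrightarrow> x = y \<or> x \<sqsubset> y \<or> y \<sqsubset> x" if "x \<in> X" "y \<in> X"
    using that unfolding comp_def by blast
  have 1: "comp x \<subseteq> comp y" if "x \<sqsubset> y \<or> y \<sqsubset> x" for x y
    using that fld tr no_vee no_wedge unfolding comp_def by blast
  then show "x = y \<or> x \<sqsubset> y \<or> y \<sqsubset> x \<Longrightarrow> comp x = comp y" by blast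
qed

lemma forest: "dlo_forest X r comp"
proof (rule dlo_forestI)
  show "\<exists>z\<in>X. x \<sqsubset> z \<and> z \<sqsubset> y" if "x \<sqsubset> y" for x y using dense[OF that] fld by blast
  show "\<exists>y\<in>X. y \<sqsubset> x" "\<exists>y\<in>X. x \<sqsubset> y" if "x \<in> X" for x using above[OF that] below[OF that] fld by blast+
  show "x \<sqsubset> z" if "x \<sqsubset> y" "y \<sqsubset> z" for x y z using tr that .
  show "\<not> x \<sqsubset> x" for x by (rule irr)
  show "comp x = comp y \<longleftrightarrow> x = y \<or> x \<sqsubset> y \<or> y \<sqsubset> x" if "x \<in> X" "y \<in> X" for x y
    by (rule comp_eq[OF that])
qed

lemma continuum_antichain_forest:
  "\<exists>C. maximal_antichain_in (copies X r) (\<subseteq>) C \<and> C \<approx> (UNIV :: nat set set)"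
proof (rule continuum_antichain[of id])
  show "infinite (id ` realizations F x)"
    if F: "finite F" "F \<subseteq> X" "x \<in> X" "id x \<notin> id ` F" for F x
  proof (rule infinite_realizations_interval[OF _ F(1,3)])
    show "id x \<noteq> id y" if "x \<sqsubset> y" for x y using that irr by auto
    show "x \<notin> F" using F(4) by simp
    \<comment> \<open>Points between \<open>a\<close> and \<open>b\<close> belong to the component
      of \<open>x\<close>, and \<open>f\<close> belongs to another.\<close>
    show "f \<bowtie> y" if f: "f \<in> F" "f \<bowtie> x" and y: "a \<sqsubset> x" "x \<sqsubset> b" "a \<sqsubset> y" "y \<sqsubset> b" for f a b y
    proof -
      have X: "f \<in> X" "a \<in> X" "y \<in> X" using f F(2) y fld by auto
      have "comp x = comp a" "comp y = comp a" using comp_eq X F(3) y by blast+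
      moreover have "comp f \<noteq> comp x" using comp_eq X F(3) f(2) by blast
      ultimately show ?thesis using comp_eq[of f y] X by auto
    qed
  qed
qed (simp add: copies_infinite)

lemma copies_forest:
  "B \<in> copies X r \<longleftrightarrow> B \<subseteq> X \<and> dlo_forest B r comp \<and> comp ` B \<approx> comp ` X"
  by (rule dlo_forest_copies[OF forest cX])

text \<open>A copy has as many components as \<open>X\<close>; as this number is finite, it meets
  each of them. So a single component \<open>K\<close> can be sliced while the rest of a copy is
  left alone.\<close>

lemma countable_antichain_forest:
  assumes fin: "finite (comp ` X)"
  shows "\<exists>C. maximal_antichain_in (copies X r) (\<subseteq>) C \<and> countable C \<and> infinite C"
proof -
  have cop: "B \<in> copies X r \<longleftrightarrow> B \<subseteq> X \<and> dlo_forest B r comp \<and> comp ` B = comp ` X" for B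
  proof -
    have 1: "comp ` B = comp ` X" if "B \<subseteq> X" "comp ` B \<approx> comp ` X"
    proof (rule card_subset_eq[OF fin])
      show "comp ` B \<subseteq> comp ` X" using that(1) by blast
      then have "finite (comp ` B)" using fin finite_subset by blast
      then show "card (comp ` B) = card (comp ` X)"
        using that(2) fin eqpoll_iff_card by blast
    qed
    have 2: "comp ` B \<approx> comp ` X" if "comp ` B = comp ` X"
      unfolding that by (rule eqpoll_refl)
    show ?thesis using 1 2 copies_forest[of B] by metis
  qed
  obtain x0 where "x0 \<in> X" using iX by fastforce
  define K where "K = {x \<in> X. comp x = comp x0}"
  have Kcmp: "x = y \<or> x \<sqsubset> y \<or> y \<sqsubset> x" if "x \<in> K" "y \<in> K" for x y
    using that comp_eq[of x y] unfolding K_def by auto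
  have Kcl: "x \<in> K \<longleftrightarrow> y \<in> K" if "x \<sqsubset> y" for x y
    using comp_eq[of x y] fld[OF that] that unfolding K_def by auto
  \<comment> \<open>Inside \<open>K\<close> a copy may be cut down by a convex condition without
    endpoints, as long as something of \<open>K\<close> remains; its other components are kept
    whole.\<close>
  have trim: "{x \<in> B. x \<in> K \<longrightarrow> P x} \<in> copies X r"
    if B: "B \<in> copies X r" and P: "\<exists>x\<in>B \<inter> K. P x"
      "\<And>x. x \<in> B \<Longrightarrow> x \<in> K \<Longrightarrow> P x \<Longrightarrow> (\<exists>y\<in>B. y \<sqsubset> x \<and> P y) \<and> (\<exists>y\<in>B. x \<sqsubset> y \<and> P y)"
      "\<And>x y z. x \<sqsubset> y \<Longrightarrow> y \<sqsubset> z \<Longrightarrow> P x \<Longrightarrow> P z \<Longrightarrow> P y" for B P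
  proof -
    have BX: "B \<subseteq> X" "dlo_forest B r comp" "comp ` B = comp ` X" using B cop by blast+
    define A where "A = {x \<in> B. x \<in> K \<longrightarrow> P x}"
    have "dlo_forest A r comp"
    proof (rule dlo_forest_convex[OF BX(2)])
      show "A \<subseteq> B" unfolding A_def by blast
      show "(\<exists>y\<in>A. y \<sqsubset> x) \<and> (\<exists>y\<in>A. x \<sqsubset> y)" if "x \<in> A" for x
      proof (cases "x \<in> K")
        case True
        then show ?thesis using P(2)[of x] that unfolding A_def by blast
      next
        case False
        have "x \<in> B" using that unfolding A_def by blast
        then obtain y z where "y \<in> B" "y \<sqsubset> x" "z \<in> B" "x \<sqsubset> z"
          using dlo_forestD(4,5)[OF BX(2), of x] by blast
        then show ?thesis using Kcl False unfolding A_def by blast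
      qed
      show "y \<in> A" if "x \<in> A" "z \<in> A" "y \<in> B" "x \<sqsubset> y" "y \<sqsubset> z" for x y z
        using that P(3)[of x y z] Kcl[of x y] Kcl[of y z] unfolding A_def by blast
    qed
    moreover have "comp ` X \<subseteq> comp ` A"
    proof
      fix k assume "k \<in> comp ` X"
      then obtain x where x: "x \<in> B" "k = comp x" using BX(3) by blast
      obtain w where w: "w \<in> B" "w \<in> K" "P w" using P(1) by blast
      show "k \<in> comp ` A"
      proof (cases "x \<in> K")
        case True
        then have "comp w = k" using x w unfolding K_def by simp
        then show ?thesis using w unfolding A_def by blast
      next
        case False
        then show ?thesis using x unfolding A_def by blast
      qed
    qed
    then have "comp ` A = comp ` X" using BX(1) unfolding A_def by blast
    ultimately show ?thesis using cop[of A] BX(1) unfolding A_def by blast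
  qed
  have meets: "B \<inter> K \<noteq> {}" if "B \<in> copies X r" for B
  proof -
    have "comp x0 \<in> comp ` B" "B \<subseteq> X" using that cop \<open>x0 \<in> X\<close> by auto
    then show ?thesis unfolding K_def by fastforce
  qed
  have below: "{x \<in> B. x \<in> K \<longrightarrow> x \<sqsubset> b} \<in> copies X r"
    if B: "B \<in> copies X r" and b: "b \<in> B" "b \<in> K" for B b
  proof (rule trim[OF B])
    have BX: "dlo_forest B r comp" using B cop by blast
    note D = dlo_forestD[OF BX]
    show "\<exists>x\<in>B \<inter> K. x \<sqsubset> b" using D(4)[OF b(1)] Kcl b(2) by blast
    show "(\<exists>y\<in>B. y \<sqsubset> x \<and> y \<sqsubset> b) \<and> (\<exists>y\<in>B. x \<sqsubset> y \<and> y \<sqsubset> b)" if "x \<in> B" "x \<sqsubset> b" for x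
      using D(4)[OF that(1)] D(6)[OF that(1) b(1) that(2)] that(2) tr by blast
    show "x \<sqsubset> y \<Longrightarrow> y \<sqsubset> z \<Longrightarrow> x \<sqsubset> b \<Longrightarrow> z \<sqsubset> b \<Longrightarrow> y \<sqsubset> b" for x y z using tr by blast
  qed
  show ?thesis
  proof (rule countable_antichain[of K])
    show "K \<subseteq> X" unfolding K_def by blast
    show "K \<noteq> {}" using \<open>x0 \<in> X\<close> unfolding K_def by blast
    show "\<exists>u\<in>K. x \<sqsubset> u \<and> y \<sqsubset> u" if xy: "x \<in> K" "y \<in> K" for x y
    proof -
      obtain u where u: "x \<sqsubset> u" using above xy(1) unfolding K_def by blast
      obtain v where v: "y \<sqsubset> v" using above xy(2) unfolding K_def by blast
      have "x \<sqsubset> v \<or> y \<sqsubset> u" using Kcmp[OF xy] u v tr by blast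
      then show ?thesis using u v Kcl xy by blast
    qed
    show "B \<inter> K \<noteq> {}" if "B \<in> copies X r" for B by (rule meets[OF that])
    show "{x \<in> X. x \<in> K \<longrightarrow> x \<sqsubset> e} \<in> copies X r" if "e \<in> K" for e
      using below[OF copies_self _ that] that unfolding K_def by blast
    show "\<exists>B'\<in>copies X r. B' \<subseteq> {x \<in> B. x \<in> K \<longrightarrow> x \<sqsubset> b}"
      if "B \<in> copies X r" "b \<in> B" "b \<in> K" for B b
      using below[OF that] by blast
    show "\<exists>M\<in>copies X r. {x \<in> X. x \<in> K \<longrightarrow> x \<sqsubset> e \<and> (\<exists>y\<in>K. y \<sqsubset> x \<and> \<not> y \<sqsubset> d)} \<subseteq> M \<and>
        M \<subseteq> {x. x \<in> K \<longrightarrow> x \<sqsubset> e \<and> \<not> x \<sqsubset> d}"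
      if d: "d \<in> K" and e: "e \<in> K" and de: "d \<sqsubset> e" for d e
    proof (intro bexI conjI)
      have "d \<sqsubset> x" if "x \<in> K" "y \<sqsubset> x" "\<not> y \<sqsubset> d" for x y
        using Kcmp[OF that(1) d] that tr by blast
      then show "{x \<in> X. x \<in> K \<longrightarrow> x \<sqsubset> e \<and> (\<exists>y\<in>K. y \<sqsubset> x \<and> \<not> y \<sqsubset> d)}
          \<subseteq> {x \<in> X. x \<in> K \<longrightarrow> d \<sqsubset> x \<and> x \<sqsubset> e}" by blast
      show "{x \<in> X. x \<in> K \<longrightarrow> d \<sqsubset> x \<and> x \<sqsubset> e} \<subseteq> {x. x \<in> K \<longrightarrow> x \<sqsubset> e \<and> \<not> x \<sqsubset> d}"
        using asym by blast
      show "{x \<in> X. x \<in> K \<longrightarrow> d \<sqsubset> x \<and> x \<sqsubset> e} \<in> copies X r"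
      proof (rule trim[OF copies_self])
        show "\<exists>x\<in>X \<inter> K. d \<sqsubset> x \<and> x \<sqsubset> e" using dense[OF de] Kcl d fld by blast
        show "(\<exists>y\<in>X. y \<sqsubset> x \<and> d \<sqsubset> y \<and> y \<sqsubset> e) \<and> (\<exists>y\<in>X. x \<sqsubset> y \<and> d \<sqsubset> y \<and> y \<sqsubset> e)"
          if x: "d \<sqsubset> x \<and> x \<sqsubset> e" for x
          using dense[of d x] dense[of x e] x tr fld by blast
        show "d \<sqsubset> y \<and> y \<sqsubset> e"
          if "x \<sqsubset> y" "y \<sqsubset> z" "d \<sqsubset> x \<and> x \<sqsubset> e" "d \<sqsubset> z \<and> z \<sqsubset> e" for x y z
          using that tr by blast
      qed
    qed
  qed
qed

end

lemma B_omega_forest: "dlo_forest UNIV B_omega_less fst"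
proof (rule dlo_forestI)
  show "\<exists>y\<in>UNIV. B_omega_less y x" "\<exists>y\<in>UNIV. B_omega_less x y" for x
  proof -
    have "B_omega_less (fst x, snd x - 1) x" "B_omega_less x (fst x, snd x + 1)"
      unfolding B_omega_less_def by auto
    then show "\<exists>y\<in>UNIV. B_omega_less y x" "\<exists>y\<in>UNIV. B_omega_less x y" by blast+
  qed
  show "\<exists>z\<in>UNIV. B_omega_less x z \<and> B_omega_less z y" if xy: "B_omega_less x y" for x y
  proof -
    obtain q where "snd x < q" "q < snd y" using xy dense[of "snd x" "snd y"] unfolding B_omega_less_def by blast
    then show ?thesis using xy unfolding B_omega_less_def by (intro bexI[of _ "(fst x, q)"]) auto
  qed
qed (auto simp: B_omega_less_def prod_eq_iff)

lemma range_fst_B_omega: "range (fst :: nat \<times> rat \<Rightarrow> nat) = UNIV"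
  by (metis fst_conv surjI surj_def)

section \<open>Classification and conclusion\<close>

context hposet_ne
begin

text \<open>Suppose there is no wedge. Moving \<open>p\<close> onto \<open>t\<close> sends
  \<open>q\<close> to a point \<open>u\<close> that forms an antichain with \<open>p\<close> and
  \<open>q\<close>. Exchanging \<open>u\<close> and \<open>p\<close> with \<open>q\<close> fixed
  puts \<open>t\<close> and its image both below \<open>q\<close>, hence makes them comparable,
  which contradicts their relations to \<open>u\<close> and \<open>p\<close>.\<close>

lemma wedge_if_vee:
  assumes "\<exists>x y z. x \<sqsubset> y \<and> x \<sqsubset> z \<and> y \<bowtie> z"
  shows "\<exists>x y z. y \<sqsubset> x \<and> z \<sqsubset> x \<and> y \<bowtie> z"
proof (rule ccontr)
  assume no: "\<not> ?thesis"
  obtain t p q where t: "t \<sqsubset> p" "t \<sqsubset> q" "p \<bowtie> q" using assms by blast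
  have X: "t \<in> X" "p \<in> X" "q \<in> X" using t fld by blast+
  obtain h where h: "aut h" "h p = t" using hom1[OF X(2,1)] .
  define u where "u = h q"
  have u: "u \<in> X" "u \<bowtie> t"
    using autD[OF h(1)] X h(2) t(3) unfolding u_def by blast+
  have "u \<bowtie> p" "u \<bowtie> q" using no t(1,2) u(2) tr by blast+
  then have "same r r u p p u" "same r r u p q q" "same r r p u q q"
    using t(3) unfolding same_def by blast+
  then obtain g where g: "aut g" "g u = p" "g p = u" "g q = q"
    using hom3[of u p p u q q] X u(1) by auto
  have t': "g t \<sqsubset> u" "g t \<sqsubset> q" "g t \<bowtie> p"
    using autD[OF g(1)] X u t(1,2) g(2-4) by metis+
  then have "g t \<sqsubset> t \<or> t \<sqsubset> g t \<or> g t = t" using no t(2) by blast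
  then show False using t' t(1) u(2) tr by metis
qed

lemma vee_if_wedge:
  assumes "\<exists>x y z. y \<sqsubset> x \<and> z \<sqsubset> x \<and> y \<bowtie> z"
  shows "\<exists>x y z. x \<sqsubset> y \<and> x \<sqsubset> z \<and> y \<bowtie> z"
proof -
  interpret d: hposet_ne X "\<lambda>x y. y \<sqsubset> x" by (rule dual_ne)
  show ?thesis using d.wedge_if_vee assms by blast
qed

text \<open>By homogeneity every incomparable pair is the image of the feet of one wedge.\<close>

lemma up_if_wedge:
  assumes "\<exists>x y z. y \<sqsubset> x \<and> z \<sqsubset> x \<and> y \<bowtie> z" "x \<in> X" "y \<in> X"
  shows "\<exists>u. x \<sqsubset> u \<and> y \<sqsubset> u"
proof (cases "x \<bowtie> y")
  case True
  obtain v a b where v: "a \<sqsubset> v" "b \<sqsubset> v" "a \<bowtie> b" using assms(1) by blast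
  have X: "a \<in> X" "b \<in> X" "v \<in> X" using v fld by blast+
  have "same r r a x b y" using True v(3) unfolding same_def by blast
  then obtain g where g: "aut g" "g a = x" "g b = y" using hom2[of a x b y] X assms(2,3) by auto
  have "x \<sqsubset> g v" "y \<sqsubset> g v" using autD[OF g(1)] X v g(2,3) by metis+
  then show ?thesis by blast
next
  case False
  obtain u where u: "x \<sqsubset> u" using above[OF assms(2)] by blast
  obtain v where v: "y \<sqsubset> v" using above[OF assms(3)] by blast
  show ?thesis using False u v tr by blast
qed

lemma directed_if_wedge:
  assumes "\<exists>x y z. y \<sqsubset> x \<and> z \<sqsubset> x \<and> y \<bowtie> z"
  shows "hposet_dir X r"
proof
  interpret d: hposet_ne X "\<lambda>x y. y \<sqsubset> x" by (rule dual_ne)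
  show "\<exists>u. x \<sqsubset> u \<and> y \<sqsubset> u" if "x \<in> X" "y \<in> X" for x y
    by (rule up_if_wedge[OF assms that])
  show "\<exists>u. u \<sqsubset> x \<and> u \<sqsubset> y" if "x \<in> X" "y \<in> X" for x y
    using d.up_if_wedge[OF _ that] vee_if_wedge[OF assms] by blast
qed

end

context hposet
begin

text \<open>Failure of transitivity of incomparability is a point beside a two-element chain. A
  wedge then makes the order directed both ways; without wedges there are no vees either, and
  comparability is transitive.\<close>

lemma trichotomy:
  assumes "a \<sqsubset> b"
  shows "hposet_weak X r \<or> hposet_forest X r \<or> hposet_gen X r"
proof -
  interpret hposet_ne X r by unfold_locales (use assms in blast)
  show ?thesis
  proof (cases "\<forall>x y z. {x, y, z} \<subseteq> X \<longrightarrow> x \<bowtie> y \<longrightarrow> y \<bowtie> z \<longrightarrow> x = z \<or> x \<bowtie> z")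
    case True
    then have "hposet_weak X r" by unfold_locales blast
    then show ?thesis by blast
  next
    case False
    then obtain x y z where xyz: "{x, y, z} \<subseteq> X" "x \<bowtie> y" "y \<bowtie> z" "x \<noteq> z" "\<not> x \<bowtie> z" by blast
    have onetwo: "\<exists>p q s. {p, q, s} \<subseteq> X \<and> p \<bowtie> q \<and> p \<bowtie> s \<and> q \<sqsubset> s"
    proof (cases "x \<sqsubset> z")
      case True
      then show ?thesis using xyz by (intro exI[of _ y] exI[of _ x] exI[of _ z]) auto
    next
      case False
      then show ?thesis using xyz by (intro exI[of _ y] exI[of _ z] exI[of _ x]) auto
    qed
    show ?thesis
    proof (cases "\<exists>x y z. y \<sqsubset> x \<and> z \<sqsubset> x \<and> y \<bowtie> z")
      case True
      then interpret hposet_dir X r by (rule directed_if_wedge)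
      have "hposet_gen X r" by unfold_locales (rule onetwo)
      then show ?thesis by blast
    next
      case False
      then have "\<not> (\<exists>x y z. x \<sqsubset> y \<and> x \<sqsubset> z \<and> y \<bowtie> z)" using wedge_if_vee by blast
      then have "hposet_forest X r" using False by unfold_locales blast+
      then show ?thesis by blast
    qed
  qed
qed

lemma continuum_antichain_exists:
  "\<exists>C. maximal_antichain_in (copies X r) (\<subseteq>) C \<and> C \<approx> (UNIV :: nat set set)"
proof (cases "\<exists>a b. a \<sqsubset> b")
  case True
  then consider "hposet_weak X r" | "hposet_forest X r" | "hposet_gen X r"
    using trichotomy by blast
  then show ?thesis
    by cases (rule hposet_weak.continuum_antichain_weak hposet_forest.continuum_antichain_forest
        hposet_gen.continuum_antichain_gen, assumption)+
next
  case False
  show ?thesis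
  proof (rule continuum_antichain[of id])
    show "infinite (id ` realizations F x)"
      if "finite F" "F \<subseteq> X" "x \<in> X" "id x \<notin> id ` F" for F x
    proof -
      \<comment> \<open>With no comparable pairs all points outside \<open>F\<close> have the same
        type over \<open>F\<close>.\<close>
      have "X - F \<subseteq> realizations F x" using False unfolding realizations_def by blast
      moreover have "infinite (X - F)" using iX that(1) by simp
      ultimately show ?thesis using finite_subset by auto
    qed
  qed (simp add: copies_infinite)
qed

lemma countable_antichain_exists:
  assumes "\<not> isomorphic X r (UNIV :: nat set) A_omega_less"
    and "\<not> isomorphic X r (UNIV :: (nat \<times> rat) set) B_omega_less"
  shows "\<exists>C. maximal_antichain_in (copies X r) (\<subseteq>) C \<and> countable C \<and> infinite C"
proof (cases "\<exists>a b. a \<sqsubset> b")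
  case True
  then consider "hposet_weak X r" | "hposet_forest X r" | "hposet_gen X r"
    using trichotomy by blast
  then show ?thesis
  proof cases
    case 1
    then show ?thesis by (rule hposet_weak.countable_antichain_weak)
  next
    case 2
    then interpret hposet_forest X r .
    \<comment> \<open>Infinitely many components would make \<open>X\<close> isomorphic to the
      excluded order on \<open>nat \<times> rat\<close>.\<close>
    have "finite (comp ` X)"
    proof (rule ccontr)
      assume "infinite (comp ` X)"
      then have "bij_betw (to_nat_on (comp ` X)) (comp ` X) UNIV"
        using to_nat_on_infinite cX by blast
      then have "comp ` X \<approx> range (fst :: nat \<times> rat \<Rightarrow> nat)"
        unfolding range_fst_B_omega eqpoll_def by blast
      then show False
        using dlo_forest_isomorphic[OF forest cX B_omega_forest] assms(2) by blast
    qed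
    then show ?thesis by (rule countable_antichain_forest)
  next
    case 3
    then show ?thesis by (rule hposet_gen.countable_antichain_gen)
  qed
next
  case False
  then have "rel_iso X r UNIV A_omega_less (to_nat_on X)"
    using to_nat_on_infinite[OF cX iX] unfolding rel_iso_def A_omega_less_def by blast
  then show ?thesis using assms(1) unfolding isomorphic_def by blast
qed

text \<open>Every infinite subset is a copy, so the blocks of the diagonal argument are single
  points, named by themselves.\<close>

lemma no_countable_antichain_A_omega:
  assumes "isomorphic X r (UNIV :: nat set) A_omega_less"
    and C: "maximal_antichain_in (copies X r) (\<subseteq>) C" "countable C" "infinite C"
  shows False
proof (rule no_countable_maximal_antichain[of X r "\<lambda>_. True" id C])
  have no: "\<not> x \<sqsubset> y" for x y
    using assms(1) fld unfolding isomorphic_def rel_iso_def A_omega_less_def by blast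
  show "B \<in> copies X r \<longleftrightarrow> B \<subseteq> X \<and> True \<and> infinite (id ` B)" for B
  proof
    assume "B \<subseteq> X \<and> True \<and> infinite (id ` B)"
    then have B: "B \<subseteq> X" "infinite B" by auto
    have "bij_betw (from_nat_into X \<circ> to_nat_on B) B X"
      using bij_betw_trans[OF to_nat_on_infinite[OF countable_subset[OF B(1) cX] B(2)]
          bij_betw_from_nat_into[OF cX iX]] .
    then show "B \<in> copies X r"
      using B(1) no unfolding copies_def isomorphic_def rel_iso_def by blast
  next
    assume "B \<in> copies X r"
    then show "B \<subseteq> X \<and> True \<and> infinite (id ` B)"
      using copies_infinite[of B] unfolding copies_def by simp
  qed
qed (use C in simp_all)

text \<open>The blocks are the components, named by the first coordinate. A copy is a union of dense
  parts without endpoints, one in each of infinitely many components.\<close>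

lemma no_countable_antichain_B_omega:
  assumes "isomorphic X r (UNIV :: (nat \<times> rat) set) B_omega_less"
    and C: "maximal_antichain_in (copies X r) (\<subseteq>) C" "countable C" "infinite C"
  shows False
proof -
  obtain f where f: "rel_iso X r (UNIV :: (nat \<times> rat) set) B_omega_less f"
    using assms(1) unfolding isomorphic_def by blast
  define c where "c = fst \<circ> f"
  have X: "dlo_forest X r c"
    unfolding c_def by (rule dlo_forest_transfer[OF f B_omega_forest])
  have "f ` X = UNIV" using f unfolding rel_iso_def bij_betw_def by blast
  then have cX': "c ` X = UNIV" unfolding c_def image_comp[symmetric] by (simp add: range_fst_B_omega)
  have inf: "S \<approx> (UNIV :: nat set) \<longleftrightarrow> infinite S" for S :: "nat set"
  proof
    show "infinite S" if "S \<approx> (UNIV :: nat set)"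
      using eqpoll_finite_iff[OF that] by simp
    show "S \<approx> (UNIV :: nat set)" if "infinite S"
      using to_nat_on_infinite[OF _ that] unfolding eqpoll_def by blast
  qed
  show False
  proof (rule no_countable_maximal_antichain[of X r "\<lambda>B. dlo_forest B r c" c C])
    show "B \<in> copies X r \<longleftrightarrow> B \<subseteq> X \<and> dlo_forest B r c \<and> infinite (c ` B)" for B
      using dlo_forest_copies[OF X cX] inf unfolding cX' by metis
    show "dlo_forest {x \<in> B. c x = k} r c" if B: "B \<subseteq> X" "dlo_forest B r c" for B k
    proof (rule dlo_forest_convex[OF B(2)])
      note D = dlo_forestD[OF B(2)]
      show "(\<exists>y\<in>{x \<in> B. c x = k}. y \<sqsubset> x) \<and> (\<exists>y\<in>{x \<in> B. c x = k}. x \<sqsubset> y)"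
        if x: "x \<in> {x \<in> B. c x = k}" for x
      proof -
        have "x \<in> B" "c x = k" using x by auto
        moreover obtain y z where "y \<in> B" "y \<sqsubset> x" "z \<in> B" "x \<sqsubset> z"
          using D(4,5)[OF \<open>x \<in> B\<close>] by blast
        moreover have "c y = c x" "c z = c x" using D(3) calculation by blast+
        ultimately show ?thesis by auto
      qed
      show "y \<in> {x \<in> B. c x = k}"
        if "x \<in> {x \<in> B. c x = k}" "y \<in> B" "x \<sqsubset> y" for x y
        using D(3)[of x y] that by auto
    qed blast
    show "dlo_forest (\<Union>i\<in>I. D i) r c"
      if "\<And>i. i \<in> I \<Longrightarrow> D i \<subseteq> X \<and> dlo_forest (D i) r c \<and> c ` D i \<subseteq> {i}" for D I
      by (rule dlo_forest_Union[OF _ X]) (use that in blast)+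
  qed (use C in auto)
qed

end

theorem theorem1p3:
  fixes X :: "'a set" and r :: "'a \<Rightarrow> 'a \<Rightarrow> bool"
  assumes "strict_poset X r"
    and "countable X" and "infinite X"
    and "ultrahomogeneous X r"
  shows "(\<exists>C. maximal_antichain_in (copies X r) (\<subseteq>) C \<and> C \<approx> (UNIV :: nat set set)) \<and>
     ((\<exists>C. maximal_antichain_in (copies X r) (\<subseteq>) C \<and> countable C \<and> infinite C) \<longleftrightarrow>
       \<not> isomorphic X r (UNIV :: nat set) A_omega_less \<and>
       \<not> isomorphic X r (UNIV :: (nat \<times> rat) set) B_omega_less)"
proof -
  define s where "s x y \<longleftrightarrow> r x y \<and> x \<in> X \<and> y \<in> X" for x y
  have sr: "s x y \<longleftrightarrow> r x y" if "x \<in> X" "y \<in> X" for x y using that unfolding s_def by simp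
  have iso: "rel_iso A s B s f \<longleftrightarrow> rel_iso A r B r f" if AB: "A \<subseteq> X" "B \<subseteq> X" for A B f
  proof -
    have "s x y \<longleftrightarrow> r x y" "s (f x) (f y) \<longleftrightarrow> r (f x) (f y)"
      if "bij_betw f A B" "x \<in> A" "y \<in> A" for x y
      using that AB sr unfolding bij_betw_def by blast+
    then show ?thesis unfolding rel_iso_def by blast
  qed
  interpret hposet X s
  proof
    show "s x y \<Longrightarrow> x \<in> X \<and> y \<in> X" for x y unfolding s_def by blast
    show "\<not> s x x" for x
      using assms(1) unfolding s_def strict_poset_def by (auto dest: irreflp_onD)
    show "s x z" if "s x y" "s y z" for x y z
      using assms(1) that unfolding s_def strict_poset_def by (auto dest: transp_onD)
    show "ultrahomogeneous X s"
      unfolding ultrahomogeneous_def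
    proof (intro allI impI)
      fix F G f assume F: "F \<subseteq> X \<and> G \<subseteq> X \<and> finite F \<and> finite G \<and> rel_iso F s G s f"
      then have "rel_iso F r G r f" using iso[of F G f] by blast
      then show "\<exists>g. rel_iso X s X s g \<and> (\<forall>x\<in>F. g x = f x)"
        using assms(4)[unfolded ultrahomogeneous_def, rule_format, of F G f] F iso[of X X] by blast
    qed
  qed (use assms in auto)
  have cop: "copies X s = copies X r" unfolding copies_def isomorphic_def using iso by blast
  have "rel_iso X s (UNIV :: nat set) t f \<longleftrightarrow> rel_iso X r UNIV t f" for t f
    using sr by (simp add: rel_iso_def)
  then have A: "isomorphic X s (UNIV :: nat set) t \<longleftrightarrow> isomorphic X r UNIV t" for t
    unfolding isomorphic_def by blast
  have "rel_iso X s (UNIV :: (nat \<times> rat) set) t f \<longleftrightarrow> rel_iso X r UNIV t f" for t f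
    using sr by (simp add: rel_iso_def)
  then have B: "isomorphic X s (UNIV :: (nat \<times> rat) set) t \<longleftrightarrow> isomorphic X r UNIV t" for t
    unfolding isomorphic_def by blast
  show ?thesis
  proof (intro conjI iffI notI)
    show "\<exists>C. maximal_antichain_in (copies X r) (\<subseteq>) C \<and> C \<approx> (UNIV :: nat set set)"
      using continuum_antichain_exists unfolding cop .
  next
    assume "\<exists>C. maximal_antichain_in (copies X r) (\<subseteq>) C \<and> countable C \<and> infinite C"
      and "isomorphic X r (UNIV :: nat set) A_omega_less"
    then show False using no_countable_antichain_A_omega[unfolded A cop] by blast
  next
    assume "\<exists>C. maximal_antichain_in (copies X r) (\<subseteq>) C \<and> countable C \<and> infinite C"
      and "isomorphic X r (UNIV :: (nat \<times> rat) set) B_omega_less"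
    then show False using no_countable_antichain_B_omega[unfolded B cop] by blast
  next
    assume "\<not> isomorphic X r (UNIV :: nat set) A_omega_less \<and>
      \<not> isomorphic X r (UNIV :: (nat \<times> rat) set) B_omega_less"
    then show "\<exists>C. maximal_antichain_in (copies X r) (\<subseteq>) C \<and> countable C \<and> infinite C"
      using countable_antichain_exists[unfolded A B cop] by blast
  qed
qed

end
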